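(* Let $\mathbb{X}$ be an additive linear category with monoidal coalgebra modality $(!,\delta,\varepsilon,m_\otimes,m_K,\Delta,e)$, and let $\nabla:=(\delta\otimes\delta)m_\otimes!(\varepsilon\otimes e+e\otimes\varepsilon)$ and $u:=m_K!(0)$ be the multiplication and unit of the induced additive bialgebra modality. For a natural transformation $\mathsf{d}:{!A}\otimes A\to{!A}$ consider the rules: - product: $\mathsf{d}\Delta=(\Delta\otimes1)\big((1\otimes\mathsf{d})+(1\otimes\sigma)(\mathsf{d}\otimes1)\big)$; - linear: $\mathsf{d}\varepsilon=e\otimes1$; - chain: $\mathsf{d}\delta=(\Delta\otimes1)(\delta\otimes\mathsf{d})\mathsf{d}$; - $\nabla$: $(\nabla\otimes1)\mathsf{d}=(1\otimes\mathsf{d})\nabla$; - monoidal: $(1\otimes\mathsf{d})m_\otimes=(\Delta\otimes1\otimes1)(1\otimes\sigma\otimes1)(m_\otimes\otimes\varepsilon\otimes1)\mathsf{d}$. Then the following are equivalent: (i) $\mathsf{d}$ is a deriving transformation; (ii) $\mathsf{d}$ satisfies the product, linear and chain rules; (iii) $\mathsf{d}$ satisfies the linear, chain and $\nabla$-rules; (iv) $\mathsf{d}$ satisfies the linear, chain and monoidal rules.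
   Context: Composition is in diagrammatic order ($fg$ means first $f$, then $g$). Symmetric monoidal categories are treated as strict (associators and unitors suppressed), with tensor $\otimes$, unit $K$, symmetry $\sigma:A\otimes B\to B\otimes A$. An additive symmetric monoidal category is a symmetric monoidal category enriched in commutative monoids (hom-sets have $+$ and $0$, no negatives, no biproducts assumed), with composition and $\otimes$ preserving $+$ and $0$ in each variable. A coalgebra modality $(!,\delta,\varepsilon,\Delta,e)$ is a comonad $(!,\delta,\varepsilon)$, $\delta:{!A}\to{!!A}$, $\varepsilon:{!A}\to A$, with natural transformations $\Delta:{!A}\to{!A}\otimes{!A}$, $e:{!A}\to K$ such that each $({!A},\Delta,e)$ is a cocommutative comonoid and $\delta\Delta=\Delta(\delta\otimes\delta)$. A monoidal coalgebra modality $(!,\delta,\varepsilon,m_\otimes,m_K,\Delta,e)$ is a coalgebra modality with a natural transformation $m_\otimes:{!A}\otimes{!B}\to{!(A\otimes B)}$ and a map $m_K:K\to{!K}$ such that: $(!,m_\otimes,m_K)$ is a (lax) symmetric monoidal endofunctor; $\delta,\varepsilon$ are monoidal: $m_\otimes\delta=(\delta\otimes\delta)m_\otimes!(m_\otimes)$, $m_K\delta=m_K!(m_K)$, $m_\otimes\varepsilon=\varepsilon\otimes\varepsilon$, $m_K\varepsilon=1$; $\Delta,e$ are monoidal: $m_\otimes\Delta=(\Delta\otimes\Delta)(1\otimes\sigma\otimes1)(m_\otimes\otimes m_\otimes)$, $m_\otimes e=e\otimes e$, $m_K\Delta=m_K\otimes m_K$, $m_Ke=1$; and $\Delta,e$ are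 $!$-coalgebra morphisms: $\delta\,!(\Delta)=\Delta(\delta\otimes\delta)m_\otimes$, $\delta\,!(e)=e\,m_K$. An additive linear category is an additive symmetric monoidal category equipped with a monoidal coalgebra modality. A deriving transformation is a natural transformation $\mathsf{d}:{!A}\otimes A\to{!A}$ satisfying the product, linear and chain rules listed in the claim (in the chain rule the last $\mathsf{d}$ is at ${!A}$), the constant rule $\mathsf{d}e=0$, and the interchange rule $(\mathsf{d}\otimes1)\mathsf{d}=(1\otimes\sigma)(\mathsf{d}\otimes1)\mathsf{d}$. *)

theory Defs
  imports Main
begin

text \<open>
  Composition is written in diagrammatic order: \<open>f \<cdot> g\<close> is first \<open>f\<close>, then \<open>g\<close>.
  The operations of a structure are total HOL functions; the locales constrain them only on the
  carriers \<open>Ob\<close> and \<open>Ar\<close>.  Symmetric monoidal categories are strict.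
\<close>

section \<open>Categories\<close>

record ('o, 'm) cat =
  Ob :: "'o set"
  Ar :: "'m set"
  Dom :: "'m \<Rightarrow> 'o"
  Cod :: "'m \<Rightarrow> 'o"
  Idt :: "'o \<Rightarrow> 'm" ("\<one>\<index>")
  Comp :: "'m \<Rightarrow> 'm \<Rightarrow> 'm" (infixl "\<cdot>\<index>" 70)

definition Hom :: "('o, 'm, 'z) cat_scheme \<Rightarrow> 'o \<Rightarrow> 'o \<Rightarrow> 'm set" ("Hom\<index>")
  where "Hom\<^bsub>X\<^esub> A B = {f \<in> Ar X. Dom X f = A \<and> Cod X f = B}"

locale category =
  fixes X :: "('o, 'm, 'z) cat_scheme" (structure)
  assumes dom_in: "f \<in> Ar X \<Longrightarrow> Dom X f \<in> Ob X"
    and cod_in: "f \<in> Ar X \<Longrightarrow> Cod X f \<in> Ob X"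
    and id_hom: "A \<in> Ob X \<Longrightarrow> \<one> A \<in> Hom A A"
    and comp_hom: "\<lbrakk>f \<in> Hom A B; g \<in> Hom B C\<rbrakk> \<Longrightarrow> f \<cdot> g \<in> Hom A C"
    and id_left: "f \<in> Hom A B \<Longrightarrow> \<one> A \<cdot> f = f"
    and id_right: "f \<in> Hom A B \<Longrightarrow> f \<cdot> \<one> B = f"
    and comp_assoc: "\<lbrakk>f \<in> Hom A B; g \<in> Hom B C; h \<in> Hom C D\<rbrakk> \<Longrightarrow> (f \<cdot> g) \<cdot> h = f \<cdot> (g \<cdot> h)"
begin

definition endofunctor :: "('o \<Rightarrow> 'o) \<Rightarrow> ('m \<Rightarrow> 'm) \<Rightarrow> bool"
  where "endofunctor Fo Fm \<longleftrightarrow>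
    (\<forall>A \<in> Ob X. Fo A \<in> Ob X) \<and>
    (\<forall>A B. \<forall>f \<in> Hom A B. Fm f \<in> Hom (Fo A) (Fo B)) \<and>
    (\<forall>A \<in> Ob X. Fm (\<one> A) = \<one> (Fo A)) \<and>
    (\<forall>A B C. \<forall>f \<in> Hom A B. \<forall>g \<in> Hom B C. Fm (f \<cdot> g) = Fm f \<cdot> Fm g)"

definition natural ::
    "('o \<Rightarrow> 'o) \<Rightarrow> ('m \<Rightarrow> 'm) \<Rightarrow> ('o \<Rightarrow> 'o) \<Rightarrow> ('m \<Rightarrow> 'm) \<Rightarrow> ('o \<Rightarrow> 'm) \<Rightarrow> bool"
  where "natural Fo Fm Go Gm t \<longleftrightarrow>
    (\<forall>A \<in> Ob X. t A \<in> Hom (Fo A) (Go A)) \<and>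
    (\<forall>A B. \<forall>f \<in> Hom A B. Fm f \<cdot> t B = t A \<cdot> Gm f)"

definition comonad :: "('o \<Rightarrow> 'o) \<Rightarrow> ('m \<Rightarrow> 'm) \<Rightarrow> ('o \<Rightarrow> 'm) \<Rightarrow> ('o \<Rightarrow> 'm) \<Rightarrow> bool"
  where "comonad Fo Fm dl ep \<longleftrightarrow>
    endofunctor Fo Fm \<and>
    natural Fo Fm (\<lambda>A. Fo (Fo A)) (\<lambda>f. Fm (Fm f)) dl \<and>
    natural Fo Fm (\<lambda>A. A) (\<lambda>f. f) ep \<and>
    (\<forall>A \<in> Ob X. dl A \<cdot> dl (Fo A) = dl A \<cdot> Fm (dl A) \<and>
      dl A \<cdot> ep (Fo A) = \<one> (Fo A) \<and>
      dl A \<cdot> Fm (ep A) = \<one> (Fo A))"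

end

section \<open>Strict symmetric monoidal categories\<close>

record ('o, 'm) smcat = "('o, 'm) cat" +
  TensO :: "'o \<Rightarrow> 'o \<Rightarrow> 'o" (infixl "\<otimes>\<^sub>o\<index>" 75)
  TensM :: "'m \<Rightarrow> 'm \<Rightarrow> 'm" (infixl "\<otimes>\<^sub>m\<index>" 75)
  Unit :: 'o ("\<K>\<index>")
  Sym :: "'o \<Rightarrow> 'o \<Rightarrow> 'm" ("\<sigma>\<index>")

locale symmetric_monoidal_category = category X
  for X :: "('o, 'm, 'z) smcat_scheme" (structure) +
  assumes tens_ob: "\<lbrakk>A \<in> Ob X; B \<in> Ob X\<rbrakk> \<Longrightarrow> A \<otimes>\<^sub>o B \<in> Ob X"
    and unit_ob: "\<K> \<in> Ob X"
    and tens_hom: "\<lbrakk>f \<in> Hom A B; g \<in> Hom C D\<rbrakk> \<Longrightarrow> f \<otimes>\<^sub>m g \<in> Hom (A \<otimes>\<^sub>o C) (B \<otimes>\<^sub>o D)"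
    and tens_id: "\<lbrakk>A \<in> Ob X; B \<in> Ob X\<rbrakk> \<Longrightarrow> \<one> A \<otimes>\<^sub>m \<one> B = \<one> (A \<otimes>\<^sub>o B)"
    and tens_comp: "\<lbrakk>f \<in> Hom A B; f' \<in> Hom B C; g \<in> Hom D E; g' \<in> Hom E F\<rbrakk>
      \<Longrightarrow> (f \<cdot> f') \<otimes>\<^sub>m (g \<cdot> g') = (f \<otimes>\<^sub>m g) \<cdot> (f' \<otimes>\<^sub>m g')"
    and tens_ob_assoc: "\<lbrakk>A \<in> Ob X; B \<in> Ob X; C \<in> Ob X\<rbrakk>
      \<Longrightarrow> (A \<otimes>\<^sub>o B) \<otimes>\<^sub>o C = A \<otimes>\<^sub>o (B \<otimes>\<^sub>o C)"
    and tens_ob_unit_left: "A \<in> Ob X \<Longrightarrow> \<K> \<otimes>\<^sub>o A = A"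
    and tens_ob_unit_right: "A \<in> Ob X \<Longrightarrow> A \<otimes>\<^sub>o \<K> = A"
    and tens_assoc: "\<lbrakk>f \<in> Ar X; g \<in> Ar X; h \<in> Ar X\<rbrakk>
      \<Longrightarrow> (f \<otimes>\<^sub>m g) \<otimes>\<^sub>m h = f \<otimes>\<^sub>m (g \<otimes>\<^sub>m h)"
    and tens_unit_left: "f \<in> Ar X \<Longrightarrow> \<one> \<K> \<otimes>\<^sub>m f = f"
    and tens_unit_right: "f \<in> Ar X \<Longrightarrow> f \<otimes>\<^sub>m \<one> \<K> = f"
    and sym_hom: "\<lbrakk>A \<in> Ob X; B \<in> Ob X\<rbrakk> \<Longrightarrow> \<sigma> A B \<in> Hom (A \<otimes>\<^sub>o B) (B \<otimes>\<^sub>o A)"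
    and sym_natural: "\<lbrakk>f \<in> Hom A B; g \<in> Hom C D\<rbrakk>
      \<Longrightarrow> (f \<otimes>\<^sub>m g) \<cdot> \<sigma> B D = \<sigma> A C \<cdot> (g \<otimes>\<^sub>m f)"
    and sym_sym: "\<lbrakk>A \<in> Ob X; B \<in> Ob X\<rbrakk> \<Longrightarrow> \<sigma> A B \<cdot> \<sigma> B A = \<one> (A \<otimes>\<^sub>o B)"
    and sym_unit: "A \<in> Ob X \<Longrightarrow> \<sigma> A \<K> = \<one> A"
    and sym_hexagon: "\<lbrakk>A \<in> Ob X; B \<in> Ob X; C \<in> Ob X\<rbrakk>
      \<Longrightarrow> \<sigma> (A \<otimes>\<^sub>o B) C = (\<one> A \<otimes>\<^sub>m \<sigma> B C) \<cdot> (\<sigma> A C \<otimes>\<^sub>m \<one> B)"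
begin

definition cocommutative_comonoid :: "'o \<Rightarrow> 'm \<Rightarrow> 'm \<Rightarrow> bool"
  where "cocommutative_comonoid C c k \<longleftrightarrow>
    C \<in> Ob X \<and> c \<in> Hom C (C \<otimes>\<^sub>o C) \<and> k \<in> Hom C \<K> \<and>
    c \<cdot> (c \<otimes>\<^sub>m \<one> C) = c \<cdot> (\<one> C \<otimes>\<^sub>m c) \<and>
    c \<cdot> (k \<otimes>\<^sub>m \<one> C) = \<one> C \<and>
    c \<cdot> (\<one> C \<otimes>\<^sub>m k) = \<one> C \<and>
    c \<cdot> \<sigma> C C = c"

end

section \<open>Additive symmetric monoidal categories\<close>

record ('o, 'm) asmcat = "('o, 'm) smcat" +
  Plus :: "'m \<Rightarrow> 'm \<Rightarrow> 'm" (infixl "\<^bold>+\<index>" 65)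
  Zero :: "'o \<Rightarrow> 'o \<Rightarrow> 'm" ("\<zero>\<index>")

locale additive_symmetric_monoidal_category = symmetric_monoidal_category X
  for X :: "('o, 'm, 'z) asmcat_scheme" (structure) +
  assumes plus_hom: "\<lbrakk>f \<in> Hom A B; g \<in> Hom A B\<rbrakk> \<Longrightarrow> f \<^bold>+ g \<in> Hom A B"
    and zero_hom: "\<lbrakk>A \<in> Ob X; B \<in> Ob X\<rbrakk> \<Longrightarrow> \<zero> A B \<in> Hom A B"
    and plus_assoc: "\<lbrakk>f \<in> Hom A B; g \<in> Hom A B; h \<in> Hom A B\<rbrakk>
      \<Longrightarrow> (f \<^bold>+ g) \<^bold>+ h = f \<^bold>+ (g \<^bold>+ h)"
    and plus_commute: "\<lbrakk>f \<in> Hom A B; g \<in> Hom A B\<rbrakk> \<Longrightarrow> f \<^bold>+ g = g \<^bold>+ f"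
    and plus_zero: "f \<in> Hom A B \<Longrightarrow> f \<^bold>+ \<zero> A B = f"
    and comp_plus_left: "\<lbrakk>f \<in> Hom A B; g \<in> Hom A B; h \<in> Hom B C\<rbrakk>
      \<Longrightarrow> (f \<^bold>+ g) \<cdot> h = f \<cdot> h \<^bold>+ g \<cdot> h"
    and comp_plus_right: "\<lbrakk>f \<in> Hom A B; g \<in> Hom B C; h \<in> Hom B C\<rbrakk>
      \<Longrightarrow> f \<cdot> (g \<^bold>+ h) = f \<cdot> g \<^bold>+ f \<cdot> h"
    and comp_zero_left: "\<lbrakk>A \<in> Ob X; f \<in> Hom B C\<rbrakk> \<Longrightarrow> \<zero> A B \<cdot> f = \<zero> A C"
    and comp_zero_right: "\<lbrakk>f \<in> Hom A B; C \<in> Ob X\<rbrakk> \<Longrightarrow> f \<cdot> \<zero> B C = \<zero> A C"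
    and tens_plus_left: "\<lbrakk>f \<in> Hom A B; g \<in> Hom A B; h \<in> Hom C D\<rbrakk>
      \<Longrightarrow> (f \<^bold>+ g) \<otimes>\<^sub>m h = f \<otimes>\<^sub>m h \<^bold>+ g \<otimes>\<^sub>m h"
    and tens_plus_right: "\<lbrakk>f \<in> Hom A B; g \<in> Hom C D; h \<in> Hom C D\<rbrakk>
      \<Longrightarrow> f \<otimes>\<^sub>m (g \<^bold>+ h) = f \<otimes>\<^sub>m g \<^bold>+ f \<otimes>\<^sub>m h"
    and tens_zero_left: "\<lbrakk>A \<in> Ob X; B \<in> Ob X; f \<in> Hom C D\<rbrakk>
      \<Longrightarrow> \<zero> A B \<otimes>\<^sub>m f = \<zero> (A \<otimes>\<^sub>o C) (B \<otimes>\<^sub>o D)"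
    and tens_zero_right: "\<lbrakk>f \<in> Hom A B; C \<in> Ob X; D \<in> Ob X\<rbrakk>
      \<Longrightarrow> f \<otimes>\<^sub>m \<zero> C D = \<zero> (A \<otimes>\<^sub>o C) (B \<otimes>\<^sub>o D)"

section \<open>Coalgebra modalities\<close>

text \<open>
  The locales for (monoidal) coalgebra modalities do not mention \<open>Plus\<close> and \<open>Zero\<close>; these fields
  are in the record only so that one structure carries all the data of an additive linear category.
\<close>

record ('o, 'm) lincat = "('o, 'm) asmcat" +
  BangO :: "'o \<Rightarrow> 'o" ("!\<^sub>o\<index>_" [101] 100)
  BangM :: "'m \<Rightarrow> 'm" ("!\<^sub>m\<index>_" [101] 100)
  Delta :: "'o \<Rightarrow> 'm" ("\<delta>\<index>")
  Eps :: "'o \<Rightarrow> 'm" ("\<epsilon>\<index>")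
  Dup :: "'o \<Rightarrow> 'm" ("\<Delta>\<index>")
  Era :: "'o \<Rightarrow> 'm" ("\<e>\<index>")
  MTens :: "'o \<Rightarrow> 'o \<Rightarrow> 'm" ("\<m>\<^sub>\<otimes>\<index>")
  MUnit :: 'm ("\<m>\<^sub>K\<index>")

locale coalgebra_modality = symmetric_monoidal_category X
  for X :: "('o, 'm, 'z) lincat_scheme" (structure) +
  assumes comonad: "comonad (BangO X) (BangM X) \<delta> \<epsilon>"
    and Delta_natural:
      "natural (BangO X) (BangM X) (\<lambda>A. !\<^sub>o A \<otimes>\<^sub>o !\<^sub>o A) (\<lambda>f. !\<^sub>m f \<otimes>\<^sub>m !\<^sub>m f) \<Delta>"
    and e_natural: "natural (BangO X) (BangM X) (\<lambda>A. \<K>) (\<lambda>f. \<one> \<K>) \<e>"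
    and comonoid: "A \<in> Ob X \<Longrightarrow> cocommutative_comonoid (!\<^sub>o A) (\<Delta> A) (\<e> A)"
    and delta_Delta: "A \<in> Ob X \<Longrightarrow> \<delta> A \<cdot> \<Delta> (!\<^sub>o A) = \<Delta> A \<cdot> (\<delta> A \<otimes>\<^sub>m \<delta> A)"
begin

definition natural_d :: "('o \<Rightarrow> 'm) \<Rightarrow> bool"
  where "natural_d d \<longleftrightarrow>
    natural (\<lambda>A. !\<^sub>o A \<otimes>\<^sub>o A) (\<lambda>f. !\<^sub>m f \<otimes>\<^sub>m f) (BangO X) (BangM X) d"

definition constant_rule :: "('o \<Rightarrow> 'm) \<Rightarrow> bool"
  where "constant_rule d \<longleftrightarrow> (\<forall>A \<in> Ob X. d A \<cdot> \<e> A = \<zero> (!\<^sub>o A \<otimes>\<^sub>o A) \<K>)"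

definition product_rule :: "('o \<Rightarrow> 'm) \<Rightarrow> bool"
  where "product_rule d \<longleftrightarrow> (\<forall>A \<in> Ob X.
    d A \<cdot> \<Delta> A =
      (\<Delta> A \<otimes>\<^sub>m \<one> A) \<cdot>
        (\<one> (!\<^sub>o A) \<otimes>\<^sub>m d A \<^bold>+ (\<one> (!\<^sub>o A) \<otimes>\<^sub>m \<sigma> (!\<^sub>o A) A) \<cdot> (d A \<otimes>\<^sub>m \<one> (!\<^sub>o A))))"

definition linear_rule :: "('o \<Rightarrow> 'm) \<Rightarrow> bool"
  where "linear_rule d \<longleftrightarrow> (\<forall>A \<in> Ob X. d A \<cdot> \<epsilon> A = \<e> A \<otimes>\<^sub>m \<one> A)"

definition chain_rule :: "('o \<Rightarrow> 'm) \<Rightarrow> bool"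
  where "chain_rule d \<longleftrightarrow> (\<forall>A \<in> Ob X.
    d A \<cdot> \<delta> A = (\<Delta> A \<otimes>\<^sub>m \<one> A) \<cdot> (\<delta> A \<otimes>\<^sub>m d A) \<cdot> d (!\<^sub>o A))"

definition interchange_rule :: "('o \<Rightarrow> 'm) \<Rightarrow> bool"
  where "interchange_rule d \<longleftrightarrow> (\<forall>A \<in> Ob X.
    (d A \<otimes>\<^sub>m \<one> A) \<cdot> d A = (\<one> (!\<^sub>o A) \<otimes>\<^sub>m \<sigma> A A) \<cdot> (d A \<otimes>\<^sub>m \<one> A) \<cdot> d A)"

definition deriving_transformation :: "('o \<Rightarrow> 'm) \<Rightarrow> bool"
  where "deriving_transformation d \<longleftrightarrow>
    natural_d d \<and> constant_rule d \<and> product_rule d \<and> linear_rule d \<and> chain_rule d \<and>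
    interchange_rule d"

end

locale monoidal_coalgebra_modality = coalgebra_modality X
  for X :: "('o, 'm, 'z) lincat_scheme" (structure) +
  assumes m_hom: "\<lbrakk>A \<in> Ob X; B \<in> Ob X\<rbrakk>
      \<Longrightarrow> \<m>\<^sub>\<otimes> A B \<in> Hom (!\<^sub>o A \<otimes>\<^sub>o !\<^sub>o B) (!\<^sub>o (A \<otimes>\<^sub>o B))"
    and mK_hom: "\<m>\<^sub>K \<in> Hom \<K> (!\<^sub>o \<K>)"
    \<comment> \<open>\<open>!\<close> is a lax symmetric monoidal functor\<close>
    and m_natural: "\<lbrakk>f \<in> Hom A B; g \<in> Hom C D\<rbrakk>
      \<Longrightarrow> (!\<^sub>m f \<otimes>\<^sub>m !\<^sub>m g) \<cdot> \<m>\<^sub>\<otimes> B D = \<m>\<^sub>\<otimes> A C \<cdot> !\<^sub>m (f \<otimes>\<^sub>m g)"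
    and m_assoc: "\<lbrakk>A \<in> Ob X; B \<in> Ob X; C \<in> Ob X\<rbrakk>
      \<Longrightarrow> (\<m>\<^sub>\<otimes> A B \<otimes>\<^sub>m \<one> (!\<^sub>o C)) \<cdot> \<m>\<^sub>\<otimes> (A \<otimes>\<^sub>o B) C =
          (\<one> (!\<^sub>o A) \<otimes>\<^sub>m \<m>\<^sub>\<otimes> B C) \<cdot> \<m>\<^sub>\<otimes> A (B \<otimes>\<^sub>o C)"
    and m_unit_left: "A \<in> Ob X \<Longrightarrow> (\<m>\<^sub>K \<otimes>\<^sub>m \<one> (!\<^sub>o A)) \<cdot> \<m>\<^sub>\<otimes> \<K> A = \<one> (!\<^sub>o A)"
    and m_unit_right: "A \<in> Ob X \<Longrightarrow> (\<one> (!\<^sub>o A) \<otimes>\<^sub>m \<m>\<^sub>K) \<cdot> \<m>\<^sub>\<otimes> A \<K> = \<one> (!\<^sub>o A)"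
    and m_sym: "\<lbrakk>A \<in> Ob X; B \<in> Ob X\<rbrakk>
      \<Longrightarrow> \<sigma> (!\<^sub>o A) (!\<^sub>o B) \<cdot> \<m>\<^sub>\<otimes> B A = \<m>\<^sub>\<otimes> A B \<cdot> !\<^sub>m (\<sigma> A B)"
    \<comment> \<open>\<open>\<delta>\<close> and \<open>\<epsilon>\<close> are monoidal\<close>
    and m_delta: "\<lbrakk>A \<in> Ob X; B \<in> Ob X\<rbrakk>
      \<Longrightarrow> \<m>\<^sub>\<otimes> A B \<cdot> \<delta> (A \<otimes>\<^sub>o B) =
          (\<delta> A \<otimes>\<^sub>m \<delta> B) \<cdot> \<m>\<^sub>\<otimes> (!\<^sub>o A) (!\<^sub>o B) \<cdot> !\<^sub>m (\<m>\<^sub>\<otimes> A B)"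
    and mK_delta: "\<m>\<^sub>K \<cdot> \<delta> \<K> = \<m>\<^sub>K \<cdot> !\<^sub>m \<m>\<^sub>K"
    and m_eps: "\<lbrakk>A \<in> Ob X; B \<in> Ob X\<rbrakk> \<Longrightarrow> \<m>\<^sub>\<otimes> A B \<cdot> \<epsilon> (A \<otimes>\<^sub>o B) = \<epsilon> A \<otimes>\<^sub>m \<epsilon> B"
    and mK_eps: "\<m>\<^sub>K \<cdot> \<epsilon> \<K> = \<one> \<K>"
    \<comment> \<open>\<open>\<Delta>\<close> and \<open>\<e>\<close> are monoidal\<close>
    and m_Delta: "\<lbrakk>A \<in> Ob X; B \<in> Ob X\<rbrakk>
      \<Longrightarrow> \<m>\<^sub>\<otimes> A B \<cdot> \<Delta> (A \<otimes>\<^sub>o B) =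
          (\<Delta> A \<otimes>\<^sub>m \<Delta> B) \<cdot> (\<one> (!\<^sub>o A) \<otimes>\<^sub>m \<sigma> (!\<^sub>o A) (!\<^sub>o B) \<otimes>\<^sub>m \<one> (!\<^sub>o B)) \<cdot>
          (\<m>\<^sub>\<otimes> A B \<otimes>\<^sub>m \<m>\<^sub>\<otimes> A B)"
    and m_e: "\<lbrakk>A \<in> Ob X; B \<in> Ob X\<rbrakk> \<Longrightarrow> \<m>\<^sub>\<otimes> A B \<cdot> \<e> (A \<otimes>\<^sub>o B) = \<e> A \<otimes>\<^sub>m \<e> B"
    and mK_Delta: "\<m>\<^sub>K \<cdot> \<Delta> \<K> = \<m>\<^sub>K \<otimes>\<^sub>m \<m>\<^sub>K"
    and mK_e: "\<m>\<^sub>K \<cdot> \<e> \<K> = \<one> \<K>"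
    \<comment> \<open>\<open>\<Delta>\<close> and \<open>\<e>\<close> are \<open>!\<close>-coalgebra morphisms\<close>
    and delta_bang_Delta: "A \<in> Ob X
      \<Longrightarrow> \<delta> A \<cdot> !\<^sub>m (\<Delta> A) = \<Delta> A \<cdot> (\<delta> A \<otimes>\<^sub>m \<delta> A) \<cdot> \<m>\<^sub>\<otimes> (!\<^sub>o A) (!\<^sub>o A)"
    and delta_bang_e: "A \<in> Ob X \<Longrightarrow> \<delta> A \<cdot> !\<^sub>m (\<e> A) = \<e> A \<cdot> \<m>\<^sub>K"

locale additive_linear_category =
  additive_symmetric_monoidal_category X + monoidal_coalgebra_modality X
  for X :: "('o, 'm, 'z) lincat_scheme" (structure)
begin

text \<open>Multiplication and unit of the induced additive bialgebra modality.\<close>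

definition nabla :: "'o \<Rightarrow> 'm" ("\<nabla>")
  where "\<nabla> A =
    (\<delta> A \<otimes>\<^sub>m \<delta> A) \<cdot> \<m>\<^sub>\<otimes> (!\<^sub>o A) (!\<^sub>o A) \<cdot> !\<^sub>m (\<epsilon> A \<otimes>\<^sub>m \<e> A \<^bold>+ \<e> A \<otimes>\<^sub>m \<epsilon> A)"

definition nabla_unit :: "'o \<Rightarrow> 'm"
  where "nabla_unit A = \<m>\<^sub>K \<cdot> !\<^sub>m (\<zero> \<K> A)"

definition nabla_rule :: "('o \<Rightarrow> 'm) \<Rightarrow> bool"
  where "nabla_rule d \<longleftrightarrow> (\<forall>A \<in> Ob X.
    (\<nabla> A \<otimes>\<^sub>m \<one> A) \<cdot> d A = (\<one> (!\<^sub>o A) \<otimes>\<^sub>m d A) \<cdot> \<nabla> A)"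

definition monoidal_rule :: "('o \<Rightarrow> 'm) \<Rightarrow> bool"
  where "monoidal_rule d \<longleftrightarrow> (\<forall>A \<in> Ob X. \<forall>B \<in> Ob X.
    (\<one> (!\<^sub>o A) \<otimes>\<^sub>m d B) \<cdot> \<m>\<^sub>\<otimes> A B =
      (\<Delta> A \<otimes>\<^sub>m \<one> (!\<^sub>o B) \<otimes>\<^sub>m \<one> B) \<cdot> (\<one> (!\<^sub>o A) \<otimes>\<^sub>m \<sigma> (!\<^sub>o A) (!\<^sub>o B) \<otimes>\<^sub>m \<one> B) \<cdot>
      (\<m>\<^sub>\<otimes> A B \<otimes>\<^sub>m \<epsilon> A \<otimes>\<^sub>m \<one> B) \<cdot> d (A \<otimes>\<^sub>o B))"

end

end

theory Submission
  imports Defs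
begin

text \<open>
  The constant rule is free: \<open>\<e>\<close> is invariant under \<open>!0\<close>, and \<open>(!0 \<otimes> 0) d = 0\<close>.
  Put \<open>\<eta> = (u \<otimes> 1) d : A \<rightarrow> !A\<close>, and recall that the tensor product of \<open>!\<close>-coalgebras is their
  cartesian product, so \<open>!A \<otimes> !B\<close> behaves like the missing \<open>!(A \<times> B)\<close>.

  Product, linear and chain imply monoidal: on \<open>W = !A \<otimes> !B\<close>, with \<open>p = \<epsilon> \<otimes> \<e>\<close> and \<open>q = \<e> \<otimes> \<epsilon>\<close>, the map
  \<open>\<Delta> (!p \<otimes> !q) m : !W \<rightarrow> !(A \<otimes> B)\<close> is a coalgebra morphism restricting to \<open>m\<close> along the coalgebra
  structure of \<open>W\<close>.  Its derivative in the direction \<open>u \<otimes> \<eta> : B \<rightarrow> W\<close>, which is \<open>0\<close> under \<open>p\<close> and \<open>1\<close>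
  under \<open>q\<close>, can be computed by the product rule and by the chain rule; the results are the two sides
  of the monoidal rule.

  Monoidal, linear and chain give \<open>(1 \<otimes> \<eta>) \<nabla> = d\<close>, whence the \<open>\<nabla>\<close>-rule by associativity of \<open>\<nabla>\<close>.
  Conversely the \<open>\<nabla>\<close>-rule gives this formula for \<open>d\<close>, so interchange is commutativity of \<open>\<nabla>\<close>, and the
  product rule follows from the bialgebra law and \<open>\<eta> \<Delta> = \<eta> \<otimes> u + u \<otimes> \<eta>\<close>, which is a consequence of
  naturality and linearity of \<open>\<eta>\<close> alone.
\<close>

section \<open>Rewriting in strict symmetric monoidal categories\<close>

context category
begin

text \<open>
  The side conditions below are phrased with \<open>Ar\<close>, \<open>Dom\<close> and \<open>Cod\<close> instead of \<open>Hom\<close>, so that the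
  simplifier can discharge them without guessing intermediate objects.
\<close>

lemma Hom_iff: "f \<in> Hom A B \<longleftrightarrow> f \<in> Ar X \<and> Dom X f = A \<and> Cod X f = B"
  by (simp add: Hom_def)

lemma HomI: "f \<in> Ar X \<Longrightarrow> f \<in> Hom (Dom X f) (Cod X f)"
  by (simp add: Hom_iff)

lemma typing [simp]:
  "f \<in> Ar X \<Longrightarrow> Dom X f \<in> Ob X"
  "f \<in> Ar X \<Longrightarrow> Cod X f \<in> Ob X"
  "A \<in> Ob X \<Longrightarrow> \<one> A \<in> Ar X"
  "A \<in> Ob X \<Longrightarrow> Dom X (\<one> A) = A"
  "A \<in> Ob X \<Longrightarrow> Cod X (\<one> A) = A"
  using dom_in cod_in id_hom by (auto simp: Hom_iff)

lemma comp_typing [simp]: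
  assumes "f \<in> Ar X" "g \<in> Ar X" "Cod X f = Dom X g"
  shows "f \<cdot> g \<in> Ar X" "Dom X (f \<cdot> g) = Dom X f" "Cod X (f \<cdot> g) = Cod X g"
  using comp_hom[of f "Dom X f" "Cod X f" g "Cod X g"] assms by (auto simp: Hom_iff)

lemma comp_id [simp]:
  "f \<in> Ar X \<Longrightarrow> Dom X f = A \<Longrightarrow> \<one> A \<cdot> f = f"
  "f \<in> Ar X \<Longrightarrow> Cod X f = B \<Longrightarrow> f \<cdot> \<one> B = f"
  using id_left id_right by (auto simp: Hom_iff)

lemma assoc [simp]:
  assumes "f \<in> Ar X" "g \<in> Ar X" "h \<in> Ar X" "Cod X f = Dom X g" "Cod X g = Dom X h"
  shows "(f \<cdot> g) \<cdot> h = f \<cdot> (g \<cdot> h)"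
  using comp_assoc[of f "Dom X f" "Cod X f" g "Cod X g" h "Cod X h"] assms by (simp add: Hom_iff)

text \<open>Composites are kept nested to the right, so an equation whose left side is a two-fold
  composite does not match inside a longer one; \<open>comp_eq_tail[OF eq]\<close> is the form of
  \<open>eq\<close> that does.\<close>

lemma comp_eq_tail:
  assumes "f \<cdot> g = k" "f \<in> Ar X" "g \<in> Ar X" "h \<in> Ar X" "Cod X f = Dom X g" "Cod X g = Dom X h"
  shows "f \<cdot> (g \<cdot> h) = k \<cdot> h"
  using assms by (simp flip: assoc)

end

context symmetric_monoidal_category
begin

lemma tensor_typing [simp]:
  "A \<in> Ob X \<Longrightarrow> B \<in> Ob X \<Longrightarrow> A \<otimes>\<^sub>o B \<in> Ob X"
  "\<K> \<in> Ob X"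
  "f \<in> Ar X \<Longrightarrow> g \<in> Ar X \<Longrightarrow> f \<otimes>\<^sub>m g \<in> Ar X"
  "f \<in> Ar X \<Longrightarrow> g \<in> Ar X \<Longrightarrow> Dom X (f \<otimes>\<^sub>m g) = Dom X f \<otimes>\<^sub>o Dom X g"
  "f \<in> Ar X \<Longrightarrow> g \<in> Ar X \<Longrightarrow> Cod X (f \<otimes>\<^sub>m g) = Cod X f \<otimes>\<^sub>o Cod X g"
  "A \<in> Ob X \<Longrightarrow> B \<in> Ob X \<Longrightarrow> \<sigma> A B \<in> Ar X"
  "A \<in> Ob X \<Longrightarrow> B \<in> Ob X \<Longrightarrow> Dom X (\<sigma> A B) = A \<otimes>\<^sub>o B"
  "A \<in> Ob X \<Longrightarrow> B \<in> Ob X \<Longrightarrow> Cod X (\<sigma> A B) = B \<otimes>\<^sub>o A"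
  using tens_ob unit_ob tens_hom[OF HomI HomI] sym_hom by (auto simp: Hom_iff)

lemmas tensor_strict [simp] =
  tens_ob_assoc tens_ob_unit_left tens_ob_unit_right tens_assoc tens_unit_left tens_unit_right
  tens_id

text \<open>Not a simp rule: it fuses a composite of tensors factor by factor, and is invoked,
  mostly through \<open>inter\<close>, only where that is wanted.\<close>

lemma interchange:
  assumes "f \<in> Ar X" "g \<in> Ar X" "f' \<in> Ar X" "g' \<in> Ar X"
    "Cod X f = Dom X f'" "Cod X g = Dom X g'"
  shows "(f \<otimes>\<^sub>m g) \<cdot> (f' \<otimes>\<^sub>m g') = (f \<cdot> f') \<otimes>\<^sub>m (g \<cdot> g')"
  using tens_comp[of f "Dom X f" "Cod X f" f' "Cod X f'" g "Dom X g" "Cod X g" g' "Cod X g'"] assms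
  by (simp add: Hom_iff)

lemma interchange_tail:
  assumes "f \<in> Ar X" "g \<in> Ar X" "f' \<in> Ar X" "g' \<in> Ar X" "h \<in> Ar X"
    "Cod X f = Dom X f'" "Cod X g = Dom X g'" "Cod X f' \<otimes>\<^sub>o Cod X g' = Dom X h"
  shows "(f \<otimes>\<^sub>m g) \<cdot> ((f' \<otimes>\<^sub>m g') \<cdot> h) = ((f \<cdot> f') \<otimes>\<^sub>m (g \<cdot> g')) \<cdot> h"
  using assms by (simp add: interchange flip: assoc)

text \<open>
  Tensors are normalised to the right, so the interchange law is also needed where a factor of one
  side faces two factors of the other.
\<close>

lemma interchange_split_left:
  assumes "f \<in> Ar X" "g \<in> Ar X" "k \<in> Ar X" "f' \<in> Ar X" "g' \<in> Ar X"
    "Cod X f \<otimes>\<^sub>o Cod X g = Dom X f'" "Cod X k = Dom X g'"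
  shows "(f \<otimes>\<^sub>m (g \<otimes>\<^sub>m k)) \<cdot> (f' \<otimes>\<^sub>m g') = ((f \<otimes>\<^sub>m g) \<cdot> f') \<otimes>\<^sub>m (k \<cdot> g')"
  using assms interchange[of "f \<otimes>\<^sub>m g" k f' g'] by simp

lemma interchange_split_right:
  assumes "f \<in> Ar X" "g \<in> Ar X" "k \<in> Ar X" "f' \<in> Ar X" "g' \<in> Ar X"
    "Cod X f' = Dom X f \<otimes>\<^sub>o Dom X g" "Cod X g' = Dom X k"
  shows "(f' \<otimes>\<^sub>m g') \<cdot> (f \<otimes>\<^sub>m (g \<otimes>\<^sub>m k)) = (f' \<cdot> (f \<otimes>\<^sub>m g)) \<otimes>\<^sub>m (g' \<cdot> k)"
  using assms interchange[of f' g' "f \<otimes>\<^sub>m g" k] by simp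

lemma interchange_split_left_tail:
  assumes "f \<in> Ar X" "g \<in> Ar X" "k \<in> Ar X" "f' \<in> Ar X" "g' \<in> Ar X" "h \<in> Ar X"
    "Cod X f \<otimes>\<^sub>o Cod X g = Dom X f'" "Cod X k = Dom X g'" "Cod X f' \<otimes>\<^sub>o Cod X g' = Dom X h"
  shows "(f \<otimes>\<^sub>m (g \<otimes>\<^sub>m k)) \<cdot> ((f' \<otimes>\<^sub>m g') \<cdot> h) = (((f \<otimes>\<^sub>m g) \<cdot> f') \<otimes>\<^sub>m (k \<cdot> g')) \<cdot> h"
  using assms interchange_tail[of "f \<otimes>\<^sub>m g" k f' g' h] by simp

lemma interchange_split_right_tail:
  assumes "f \<in> Ar X" "g \<in> Ar X" "k \<in> Ar X" "f' \<in> Ar X" "g' \<in> Ar X" "h \<in> Ar X"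
    "Cod X f' = Dom X f \<otimes>\<^sub>o Dom X g" "Cod X g' = Dom X k"
    "Cod X f \<otimes>\<^sub>o Cod X g \<otimes>\<^sub>o Cod X k = Dom X h"
  shows "(f' \<otimes>\<^sub>m g') \<cdot> ((f \<otimes>\<^sub>m (g \<otimes>\<^sub>m k)) \<cdot> h) = ((f' \<cdot> (f \<otimes>\<^sub>m g)) \<otimes>\<^sub>m (g' \<cdot> k)) \<cdot> h"
  using assms interchange_tail[of f' g' "f \<otimes>\<^sub>m g" k h] by simp

lemmas inter = interchange interchange_tail interchange_split_left interchange_split_right
  interchange_split_left_tail interchange_split_right_tail

text \<open>The codomains are variables tied by equations, so that the left side matches whatever
  form the simplifier has given the objects.\<close>

lemma sym_nat:
  assumes "f \<in> Ar X" "g \<in> Ar X" "Cod X f = B" "Cod X g = D"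
  shows "(f \<otimes>\<^sub>m g) \<cdot> \<sigma> B D = \<sigma> (Dom X f) (Dom X g) \<cdot> (g \<otimes>\<^sub>m f)"
  using sym_natural[OF HomI HomI, of f g] assms by simp

lemma sym_unit_left:
  assumes "A \<in> Ob X"
  shows "\<sigma> \<K> A = \<one> A"
proof -
  have "\<sigma> \<K> A = \<sigma> \<K> A \<cdot> \<sigma> A \<K>" using assms by (simp add: sym_unit)
  also have "\<dots> = \<one> A" using assms by (subst sym_sym) simp_all
  finally show ?thesis .
qed

text \<open>A constant of its own shields the inner tensor from the rules of \<open>inter\<close>,
  which could otherwise fuse it with its neighbours before naturality is applied.\<close>

definition middle_swap :: "'o \<Rightarrow> 'o \<Rightarrow> 'o \<Rightarrow> 'o \<Rightarrow> 'm"
  where "middle_swap A B C D = \<one> A \<otimes>\<^sub>m (\<sigma> B C \<otimes>\<^sub>m \<one> D)"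

lemma middle_swap_typing [simp]:
  assumes "A \<in> Ob X" "B \<in> Ob X" "C \<in> Ob X" "D \<in> Ob X"
  shows "middle_swap A B C D \<in> Ar X" "Dom X (middle_swap A B C D) = A \<otimes>\<^sub>o (B \<otimes>\<^sub>o (C \<otimes>\<^sub>o D))"
    "Cod X (middle_swap A B C D) = A \<otimes>\<^sub>o (C \<otimes>\<^sub>o (B \<otimes>\<^sub>o D))"
  using assms by (simp_all add: middle_swap_def)

lemma middle_swap_nat:
  assumes "f \<in> Ar X" "g \<in> Ar X" "h \<in> Ar X" "k \<in> Ar X"
    "Cod X f = A" "Cod X g = B" "Cod X h = C" "Cod X k = D"
  shows "(f \<otimes>\<^sub>m (g \<otimes>\<^sub>m (h \<otimes>\<^sub>m k))) \<cdot> middle_swap A B C D =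
    middle_swap (Dom X f) (Dom X g) (Dom X h) (Dom X k) \<cdot> (f \<otimes>\<^sub>m (h \<otimes>\<^sub>m (g \<otimes>\<^sub>m k)))"
  using assms by (auto simp add: middle_swap_def inter sym_nat)

text \<open>By strictness \<open>g\<close> is \<open>\<one> \<K> \<otimes>\<^sub>m g\<close>, which
  makes this an instance of interchange.\<close>

lemma scalar_tensor_comp:
  assumes "k \<in> Ar X" "f \<in> Ar X" "g \<in> Ar X" "Cod X k = \<K>" "Cod X f = Dom X g"
  shows "(k \<otimes>\<^sub>m f) \<cdot> g = k \<otimes>\<^sub>m (f \<cdot> g)"
  using assms interchange[of k f "\<one> \<K>" g] by simp

lemma whisker_comp_tail:
  assumes "f \<in> Ar X" "g \<in> Ar X" "h \<in> Ar X" "A \<in> Ob X"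
    "Cod X f = Dom X g" "Cod X g \<otimes>\<^sub>o A = Dom X h"
  shows "(f \<otimes>\<^sub>m \<one> A) \<cdot> ((g \<otimes>\<^sub>m \<one> A) \<cdot> h) = ((f \<cdot> g) \<otimes>\<^sub>m \<one> A) \<cdot> h"
  using assms by (simp add: interchange_tail)

end

context additive_symmetric_monoidal_category
begin

lemma additive_typing [simp]:
  assumes "f \<in> Ar X" "g \<in> Ar X" "Dom X g = Dom X f" "Cod X g = Cod X f"
  shows "f \<^bold>+ g \<in> Ar X" "Dom X (f \<^bold>+ g) = Dom X f" "Cod X (f \<^bold>+ g) = Cod X f"
  using plus_hom[of f "Dom X f" "Cod X f" g] assms by (auto simp: Hom_iff)

lemma zero_typing [simp]:
  assumes "A \<in> Ob X" "B \<in> Ob X"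
  shows "\<zero> A B \<in> Ar X" "Dom X (\<zero> A B) = A" "Cod X (\<zero> A B) = B"
  using zero_hom assms by (auto simp: Hom_iff)

lemma distrib:
  assumes "f \<in> Ar X" "g \<in> Ar X" "h \<in> Ar X" "Dom X g = Dom X f" "Cod X g = Cod X f"
  shows "Cod X f = Dom X h \<Longrightarrow> (f \<^bold>+ g) \<cdot> h = f \<cdot> h \<^bold>+ g \<cdot> h"
    "Cod X h = Dom X f \<Longrightarrow> h \<cdot> (f \<^bold>+ g) = h \<cdot> f \<^bold>+ h \<cdot> g"
    "(f \<^bold>+ g) \<otimes>\<^sub>m h = f \<otimes>\<^sub>m h \<^bold>+ g \<otimes>\<^sub>m h"
    "h \<otimes>\<^sub>m (f \<^bold>+ g) = h \<otimes>\<^sub>m f \<^bold>+ h \<otimes>\<^sub>m g"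
  using assms comp_plus_left[of f "Dom X f" "Cod X f" g h "Cod X h"]
    comp_plus_right[of h "Dom X h" "Dom X f" f "Cod X f" g]
    tens_plus_left[of f "Dom X f" "Cod X f" g h] tens_plus_right[of h _ _ f "Dom X f" "Cod X f" g]
  by (auto simp: Hom_iff)

lemma zero_simps [simp]:
  assumes "f \<in> Ar X" "A \<in> Ob X" "B \<in> Ob X"
  shows "Dom X f = B \<Longrightarrow> \<zero> A B \<cdot> f = \<zero> A (Cod X f)"
    "Cod X f = A \<Longrightarrow> f \<cdot> \<zero> A B = \<zero> (Dom X f) B"
    "\<zero> A B \<otimes>\<^sub>m f = \<zero> (A \<otimes>\<^sub>o Dom X f) (B \<otimes>\<^sub>o Cod X f)"
    "f \<otimes>\<^sub>m \<zero> A B = \<zero> (Dom X f \<otimes>\<^sub>o A) (Cod X f \<otimes>\<^sub>o B)"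
  using assms comp_zero_left[of A f B "Cod X f"] comp_zero_right[of f "Dom X f" A B]
    tens_zero_left[OF _ _ HomI, of A B f] tens_zero_right[OF HomI, of f A B]
  by (auto simp: Hom_iff)

lemma plus_zero_simps [simp]:
  assumes "f \<in> Ar X" "Dom X f = A" "Cod X f = B"
  shows "f \<^bold>+ \<zero> A B = f" "\<zero> A B \<^bold>+ f = f"
  using assms plus_zero[of f A B] plus_commute[of "\<zero> A B" A B f] by (auto simp: Hom_iff)

end

section \<open>Tensor products of cofree coalgebras\<close>

context coalgebra_modality
begin

lemma bang_typing [simp]:
  "A \<in> Ob X \<Longrightarrow> !\<^sub>o A \<in> Ob X"
  "f \<in> Ar X \<Longrightarrow> !\<^sub>m f \<in> Ar X"
  "f \<in> Ar X \<Longrightarrow> Dom X (!\<^sub>m f) = !\<^sub>o (Dom X f)"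
  "f \<in> Ar X \<Longrightarrow> Cod X (!\<^sub>m f) = !\<^sub>o (Cod X f)"
  using comonad HomI by (auto simp: comonad_def endofunctor_def Hom_iff)

lemma bang_id [simp]: "A \<in> Ob X \<Longrightarrow> !\<^sub>m (\<one> A) = \<one> (!\<^sub>o A)"
  using comonad by (auto simp: comonad_def endofunctor_def)

lemma bang_comp:
  assumes "f \<in> Ar X" "g \<in> Ar X" "Cod X f = Dom X g"
  shows "!\<^sub>m (f \<cdot> g) = !\<^sub>m f \<cdot> !\<^sub>m g"
  using comonad HomI[OF assms(1)] HomI[OF assms(2)] assms(3)
  by (auto simp: comonad_def endofunctor_def)

lemma modality_typing [simp]:
  assumes "A \<in> Ob X"
  shows "\<delta> A \<in> Ar X" "Dom X (\<delta> A) = !\<^sub>o A" "Cod X (\<delta> A) = !\<^sub>o (!\<^sub>o A)"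
    "\<epsilon> A \<in> Ar X" "Dom X (\<epsilon> A) = !\<^sub>o A" "Cod X (\<epsilon> A) = A"
    "\<Delta> A \<in> Ar X" "Dom X (\<Delta> A) = !\<^sub>o A" "Cod X (\<Delta> A) = !\<^sub>o A \<otimes>\<^sub>o !\<^sub>o A"
    "\<e> A \<in> Ar X" "Dom X (\<e> A) = !\<^sub>o A" "Cod X (\<e> A) = \<K>"
  using comonad Delta_natural e_natural assms
  by (auto simp: comonad_def natural_def Hom_iff)

lemma delta_nat:
  "f \<in> Ar X \<Longrightarrow> Cod X f = B \<Longrightarrow> !\<^sub>m f \<cdot> \<delta> B = \<delta> (Dom X f) \<cdot> !\<^sub>m (!\<^sub>m f)"
  using comonad HomI[of f] by (auto simp: comonad_def natural_def)

lemma eps_nat: "f \<in> Ar X \<Longrightarrow> Cod X f = B \<Longrightarrow> !\<^sub>m f \<cdot> \<epsilon> B = \<epsilon> (Dom X f) \<cdot> f"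
  using comonad HomI[of f] by (auto simp: comonad_def natural_def)

lemma Delta_nat:
  "f \<in> Ar X \<Longrightarrow> Cod X f = B \<Longrightarrow> !\<^sub>m f \<cdot> \<Delta> B = \<Delta> (Dom X f) \<cdot> (!\<^sub>m f \<otimes>\<^sub>m !\<^sub>m f)"
  using Delta_natural HomI[of f] by (auto simp: natural_def)

lemma e_nat: "f \<in> Ar X \<Longrightarrow> Cod X f = B \<Longrightarrow> !\<^sub>m f \<cdot> \<e> B = \<e> (Dom X f)"
  using e_natural HomI[of f] by (auto simp: natural_def)

lemma comonad_simps [simp]:
  assumes "A \<in> Ob X"
  shows "\<delta> A \<cdot> \<epsilon> (!\<^sub>o A) = \<one> (!\<^sub>o A)" "\<delta> A \<cdot> !\<^sub>m (\<epsilon> A) = \<one> (!\<^sub>o A)"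
  using comonad assms by (auto simp: comonad_def)

lemma delta_delta: "A \<in> Ob X \<Longrightarrow> \<delta> A \<cdot> \<delta> (!\<^sub>o A) = \<delta> A \<cdot> !\<^sub>m (\<delta> A)"
  using comonad by (auto simp: comonad_def)

lemma comonoid_simps [simp]:
  assumes "A \<in> Ob X"
  shows "\<Delta> A \<cdot> (\<e> A \<otimes>\<^sub>m \<one> (!\<^sub>o A)) = \<one> (!\<^sub>o A)" "\<Delta> A \<cdot> (\<one> (!\<^sub>o A) \<otimes>\<^sub>m \<e> A) = \<one> (!\<^sub>o A)"
  using comonoid[OF assms] by (auto simp: cocommutative_comonoid_def)

text \<open>Naturality makes \<open>\<e>\<close> invariant under
  \<open>!\<^sub>m (\<epsilon> A)\<close>, of which \<open>\<delta> A\<close> is a section.\<close>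

lemma delta_e [simp]:
  assumes "A \<in> Ob X"
  shows "\<delta> A \<cdot> \<e> (!\<^sub>o A) = \<e> A"
proof -
  have "\<delta> A \<cdot> \<e> (!\<^sub>o A) = \<delta> A \<cdot> (!\<^sub>m (\<epsilon> A) \<cdot> \<e> A)" using assms by (simp add: e_nat)
  also have "\<dots> = (\<delta> A \<cdot> !\<^sub>m (\<epsilon> A)) \<cdot> \<e> A" using assms by (subst assoc) simp_all
  finally show ?thesis using assms by simp
qed

end

context monoidal_coalgebra_modality
begin

lemma monoidal_typing [simp]:
  "A \<in> Ob X \<Longrightarrow> B \<in> Ob X \<Longrightarrow> \<m>\<^sub>\<otimes> A B \<in> Ar X"
  "A \<in> Ob X \<Longrightarrow> B \<in> Ob X \<Longrightarrow> Dom X (\<m>\<^sub>\<otimes> A B) = !\<^sub>o A \<otimes>\<^sub>o !\<^sub>o B"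
  "A \<in> Ob X \<Longrightarrow> B \<in> Ob X \<Longrightarrow> Cod X (\<m>\<^sub>\<otimes> A B) = !\<^sub>o (A \<otimes>\<^sub>o B)"
  "\<m>\<^sub>K \<in> Ar X" "Dom X \<m>\<^sub>K = \<K>" "Cod X \<m>\<^sub>K = !\<^sub>o \<K>"
  using m_hom mK_hom by (auto simp: Hom_iff)

lemma m_nat:
  assumes "f \<in> Ar X" "g \<in> Ar X" "Cod X f = B" "Cod X g = D"
  shows "(!\<^sub>m f \<otimes>\<^sub>m !\<^sub>m g) \<cdot> \<m>\<^sub>\<otimes> B D = \<m>\<^sub>\<otimes> (Dom X f) (Dom X g) \<cdot> !\<^sub>m (f \<otimes>\<^sub>m g)"
  using m_natural[OF HomI HomI, of f g] assms by simp

text \<open>The \<open>!\<close>-coalgebra and comonoid structures on \<open>!A \<otimes> !B\<close>.\<close>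

definition cotens :: "'o \<Rightarrow> 'o \<Rightarrow> 'm"
  where "cotens A B = (\<delta> A \<otimes>\<^sub>m \<delta> B) \<cdot> \<m>\<^sub>\<otimes> (!\<^sub>o A) (!\<^sub>o B)"

definition Dup2 :: "'o \<Rightarrow> 'o \<Rightarrow> 'm"
  where "Dup2 A B = (\<Delta> A \<otimes>\<^sub>m \<Delta> B) \<cdot> middle_swap (!\<^sub>o A) (!\<^sub>o A) (!\<^sub>o B) (!\<^sub>o B)"

lemma cotens_Dup2_typing [simp]:
  assumes "A \<in> Ob X" "B \<in> Ob X"
  shows "cotens A B \<in> Ar X" "Dom X (cotens A B) = !\<^sub>o A \<otimes>\<^sub>o !\<^sub>o B"
    "Cod X (cotens A B) = !\<^sub>o (!\<^sub>o A \<otimes>\<^sub>o !\<^sub>o B)"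
    "Dup2 A B \<in> Ar X" "Dom X (Dup2 A B) = !\<^sub>o A \<otimes>\<^sub>o !\<^sub>o B"
    "Cod X (Dup2 A B) = !\<^sub>o A \<otimes>\<^sub>o (!\<^sub>o B \<otimes>\<^sub>o (!\<^sub>o A \<otimes>\<^sub>o !\<^sub>o B))"
  using assms by (simp_all add: cotens_def Dup2_def)

lemma cotens_eps:
  assumes "A \<in> Ob X" "B \<in> Ob X"
  shows "cotens A B \<cdot> \<epsilon> (!\<^sub>o A \<otimes>\<^sub>o !\<^sub>o B) = \<one> (!\<^sub>o A \<otimes>\<^sub>o !\<^sub>o B)"
  using assms by (simp add: cotens_def m_eps inter)

lemma cotens_e:
  assumes "A \<in> Ob X" "B \<in> Ob X"
  shows "cotens A B \<cdot> \<e> (!\<^sub>o A \<otimes>\<^sub>o !\<^sub>o B) = \<e> A \<otimes>\<^sub>m \<e> B"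
  using assms by (simp add: cotens_def m_e inter)

text \<open>Coassociativity of the coalgebra structure: \<open>m_delta\<close> reduces it to
  \<open>delta_delta\<close> in each factor, and naturality of \<open>\<m>\<^sub>\<otimes>\<close>
  reassembles the right side.\<close>

lemma cotens_delta:
  assumes "A \<in> Ob X" "B \<in> Ob X"
  shows "cotens A B \<cdot> \<delta> (!\<^sub>o A \<otimes>\<^sub>o !\<^sub>o B) = cotens A B \<cdot> !\<^sub>m (cotens A B)"
proof -
  have "cotens A B \<cdot> \<delta> (!\<^sub>o A \<otimes>\<^sub>o !\<^sub>o B) =
    ((\<delta> A \<cdot> !\<^sub>m (\<delta> A)) \<otimes>\<^sub>m (\<delta> B \<cdot> !\<^sub>m (\<delta> B))) \<cdot> (\<m>\<^sub>\<otimes> (!\<^sub>o (!\<^sub>o A)) (!\<^sub>o (!\<^sub>o B)) \<cdot> !\<^sub>m (\<m>\<^sub>\<otimes> (!\<^sub>o A) (!\<^sub>o B)))"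
    using assms by (simp add: cotens_def m_delta inter delta_delta)
  also have "\<dots> = (\<delta> A \<otimes>\<^sub>m \<delta> B) \<cdot> ((!\<^sub>m (\<delta> A) \<otimes>\<^sub>m !\<^sub>m (\<delta> B)) \<cdot> (\<m>\<^sub>\<otimes> (!\<^sub>o (!\<^sub>o A)) (!\<^sub>o (!\<^sub>o B)) \<cdot> !\<^sub>m (\<m>\<^sub>\<otimes> (!\<^sub>o A) (!\<^sub>o B))))"
    using assms by (simp add: inter)
  also have "\<dots> = cotens A B \<cdot> !\<^sub>m (cotens A B)"
    using assms by (simp add: cotens_def bang_comp comp_eq_tail[OF m_nat])
  finally show ?thesis .
qed

lemma m_Delta':
  assumes "A \<in> Ob X" "B \<in> Ob X"
  shows "\<m>\<^sub>\<otimes> A B \<cdot> \<Delta> (A \<otimes>\<^sub>o B) = (\<Delta> A \<otimes>\<^sub>m \<Delta> B) \<cdot>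
    (middle_swap (!\<^sub>o A) (!\<^sub>o A) (!\<^sub>o B) (!\<^sub>o B) \<cdot> (\<m>\<^sub>\<otimes> A B \<otimes>\<^sub>m \<m>\<^sub>\<otimes> A B))"
  using assms by (simp add: m_Delta middle_swap_def)

text \<open>Duplication moves ahead of \<open>\<delta>\<close> by \<open>delta_Delta\<close> in each
  factor, and the four resulting copies of \<open>\<delta>\<close> pass the middle swap by
  naturality. Together with \<open>cotens_e\<close> this makes \<open>cotens\<close> a comonoid
  morphism.\<close>

lemma cotens_Delta:
  assumes "A \<in> Ob X" "B \<in> Ob X"
  shows "cotens A B \<cdot> \<Delta> (!\<^sub>o A \<otimes>\<^sub>o !\<^sub>o B) = Dup2 A B \<cdot> (cotens A B \<otimes>\<^sub>m cotens A B)"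
proof -
  have "cotens A B \<cdot> \<Delta> (!\<^sub>o A \<otimes>\<^sub>o !\<^sub>o B) = (\<Delta> A \<otimes>\<^sub>m \<Delta> B) \<cdot>
   (((\<delta> A \<otimes>\<^sub>m (\<delta> A \<otimes>\<^sub>m (\<delta> B \<otimes>\<^sub>m \<delta> B))) \<cdot> middle_swap (!\<^sub>o (!\<^sub>o A)) (!\<^sub>o (!\<^sub>o A)) (!\<^sub>o (!\<^sub>o B)) (!\<^sub>o (!\<^sub>o B))) \<cdot>
      (\<m>\<^sub>\<otimes> (!\<^sub>o A) (!\<^sub>o B) \<otimes>\<^sub>m \<m>\<^sub>\<otimes> (!\<^sub>o A) (!\<^sub>o B)))"
    using assms by (simp add: cotens_def m_Delta' inter delta_Delta)
  also have "\<dots> = Dup2 A B \<cdot> (cotens A B \<otimes>\<^sub>m cotens A B)"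
    using assms by (simp add: middle_swap_nat cotens_def Dup2_def inter)
  finally show ?thesis .
qed

text \<open>The second factor becomes \<open>\<e> B\<close> followed by \<open>\<m>\<^sub>K\<close>,
  which the unit law of \<open>\<m>\<^sub>\<otimes>\<close> absorbs. With \<open>cotens_snd\<close>
  this identifies the two projections of the product coalgebra.\<close>

lemma cotens_fst:
  assumes "A \<in> Ob X" "B \<in> Ob X"
  shows "cotens A B \<cdot> !\<^sub>m (\<epsilon> A \<otimes>\<^sub>m \<e> B) = \<one> (!\<^sub>o A) \<otimes>\<^sub>m \<e> B"
proof -
  have "cotens A B \<cdot> !\<^sub>m (\<epsilon> A \<otimes>\<^sub>m \<e> B) = (\<delta> A \<otimes>\<^sub>m \<delta> B) \<cdot> ((!\<^sub>m (\<epsilon> A) \<otimes>\<^sub>m !\<^sub>m (\<e> B)) \<cdot> \<m>\<^sub>\<otimes> A \<K>)"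
    using assms by (simp add: cotens_def m_nat)
  also have "\<dots> = (\<one> (!\<^sub>o A) \<otimes>\<^sub>m \<e> B) \<cdot> ((\<one> (!\<^sub>o A) \<otimes>\<^sub>m \<m>\<^sub>K) \<cdot> \<m>\<^sub>\<otimes> A \<K>)"
    using assms by (simp add: inter delta_bang_e)
  finally show ?thesis using assms by (simp add: m_unit_right)
qed

lemma cotens_snd:
  assumes "A \<in> Ob X" "B \<in> Ob X"
  shows "cotens A B \<cdot> !\<^sub>m (\<e> A \<otimes>\<^sub>m \<epsilon> B) = \<e> A \<otimes>\<^sub>m \<one> (!\<^sub>o B)"
proof -
  have "cotens A B \<cdot> !\<^sub>m (\<e> A \<otimes>\<^sub>m \<epsilon> B) = (\<delta> A \<otimes>\<^sub>m \<delta> B) \<cdot> ((!\<^sub>m (\<e> A) \<otimes>\<^sub>m !\<^sub>m (\<epsilon> B)) \<cdot> \<m>\<^sub>\<otimes> \<K> B)"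
    using assms by (simp add: cotens_def m_nat)
  also have "\<dots> = (\<e> A \<otimes>\<^sub>m \<one> (!\<^sub>o B)) \<cdot> ((\<m>\<^sub>K \<otimes>\<^sub>m \<one> (!\<^sub>o B)) \<cdot> \<m>\<^sub>\<otimes> \<K> B)"
    using assms by (simp add: inter delta_bang_e)
  finally show ?thesis using assms by (simp add: m_unit_left)
qed

text \<open>The erasures pass the middle swap, which then becomes a symmetry at the unit; the counit
  laws do the rest.\<close>

lemma Dup2_counit:
  assumes "A \<in> Ob X" "B \<in> Ob X"
  shows "Dup2 A B \<cdot> (\<one> (!\<^sub>o A) \<otimes>\<^sub>m (\<e> B \<otimes>\<^sub>m (\<e> A \<otimes>\<^sub>m \<one> (!\<^sub>o B)))) = \<one> (!\<^sub>o A \<otimes>\<^sub>o !\<^sub>o B)"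
proof -
  have "middle_swap (!\<^sub>o A) (!\<^sub>o A) (!\<^sub>o B) (!\<^sub>o B) \<cdot> (\<one> (!\<^sub>o A) \<otimes>\<^sub>m (\<e> B \<otimes>\<^sub>m (\<e> A \<otimes>\<^sub>m \<one> (!\<^sub>o B)))) =
    (\<one> (!\<^sub>o A) \<otimes>\<^sub>m (\<e> A \<otimes>\<^sub>m (\<e> B \<otimes>\<^sub>m \<one> (!\<^sub>o B)))) \<cdot> middle_swap (!\<^sub>o A) \<K> \<K> (!\<^sub>o B)"
    using assms by (simp add: middle_swap_nat)
  also have "\<dots> = \<one> (!\<^sub>o A) \<otimes>\<^sub>m (\<e> A \<otimes>\<^sub>m (\<e> B \<otimes>\<^sub>m \<one> (!\<^sub>o B)))"
    using assms by (simp add: middle_swap_def sym_unit)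
  finally show ?thesis
    using assms by (simp add: Dup2_def inter)
qed

text \<open>Surjective pairing for the product coalgebra: along the comonoid morphism
  \<open>cotens\<close>, \<open>\<Delta>\<close> becomes \<open>Dup2\<close>, and each copy goes to
  its own projection.\<close>

lemma cotens_pair:
  assumes "A \<in> Ob X" "B \<in> Ob X"
  shows "cotens A B \<cdot> (\<Delta> (!\<^sub>o A \<otimes>\<^sub>o !\<^sub>o B) \<cdot> (!\<^sub>m (\<epsilon> A \<otimes>\<^sub>m \<e> B) \<otimes>\<^sub>m !\<^sub>m (\<e> A \<otimes>\<^sub>m \<epsilon> B))) =
    \<one> (!\<^sub>o A \<otimes>\<^sub>o !\<^sub>o B)"
proof -
  have "cotens A B \<cdot> (\<Delta> (!\<^sub>o A \<otimes>\<^sub>o !\<^sub>o B) \<cdot> (!\<^sub>m (\<epsilon> A \<otimes>\<^sub>m \<e> B) \<otimes>\<^sub>m !\<^sub>m (\<e> A \<otimes>\<^sub>m \<epsilon> B))) =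
    Dup2 A B \<cdot> ((cotens A B \<cdot> !\<^sub>m (\<epsilon> A \<otimes>\<^sub>m \<e> B)) \<otimes>\<^sub>m (cotens A B \<cdot> !\<^sub>m (\<e> A \<otimes>\<^sub>m \<epsilon> B)))"
    using assms by (simp add: comp_eq_tail[OF cotens_Delta] inter)
  then show ?thesis
    using assms by (simp add: cotens_fst cotens_snd Dup2_counit)
qed

text \<open>Erasing the second copy of the \<open>B\<close> factor leaves only the \<open>A\<close>
  factor duplicated; this produces the first two maps on the right of the monoidal rule.\<close>

lemma Dup2_counit_right:
  assumes "A \<in> Ob X" "B \<in> Ob X"
  shows "Dup2 A B \<cdot> (\<one> (!\<^sub>o A) \<otimes>\<^sub>m (\<one> (!\<^sub>o B) \<otimes>\<^sub>m (\<one> (!\<^sub>o A) \<otimes>\<^sub>m \<e> B))) =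
    (\<Delta> A \<otimes>\<^sub>m \<one> (!\<^sub>o B)) \<cdot> (\<one> (!\<^sub>o A) \<otimes>\<^sub>m \<sigma> (!\<^sub>o A) (!\<^sub>o B))"
proof -
  have "middle_swap (!\<^sub>o A) (!\<^sub>o A) (!\<^sub>o B) (!\<^sub>o B) \<cdot> (\<one> (!\<^sub>o A) \<otimes>\<^sub>m (\<one> (!\<^sub>o B) \<otimes>\<^sub>m (\<one> (!\<^sub>o A) \<otimes>\<^sub>m \<e> B))) =
    (\<one> (!\<^sub>o A) \<otimes>\<^sub>m (\<one> (!\<^sub>o A) \<otimes>\<^sub>m (\<one> (!\<^sub>o B) \<otimes>\<^sub>m \<e> B))) \<cdot> middle_swap (!\<^sub>o A) (!\<^sub>o A) (!\<^sub>o B) \<K>"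
    using assms by (subst middle_swap_nat) simp_all
  then have "Dup2 A B \<cdot> (\<one> (!\<^sub>o A) \<otimes>\<^sub>m (\<one> (!\<^sub>o B) \<otimes>\<^sub>m (\<one> (!\<^sub>o A) \<otimes>\<^sub>m \<e> B))) =
    (\<Delta> A \<otimes>\<^sub>m \<Delta> B) \<cdot> ((\<one> (!\<^sub>o A) \<otimes>\<^sub>m (\<one> (!\<^sub>o A) \<otimes>\<^sub>m (\<one> (!\<^sub>o B) \<otimes>\<^sub>m \<e> B))) \<cdot> middle_swap (!\<^sub>o A) (!\<^sub>o A) (!\<^sub>o B) \<K>)"
    using assms by (simp add: Dup2_def)
  also have "\<dots> = (\<Delta> A \<otimes>\<^sub>m \<one> (!\<^sub>o B)) \<cdot> middle_swap (!\<^sub>o A) (!\<^sub>o A) (!\<^sub>o B) \<K>"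
    using assms by (simp add: inter)
  finally show ?thesis using assms by (simp add: middle_swap_def)
qed

end

section \<open>The bialgebra structure\<close>

context additive_linear_category
begin

lemma nabla_unit_typing [simp]:
  assumes "A \<in> Ob X"
  shows "nabla_unit A \<in> Ar X" "Dom X (nabla_unit A) = \<K>" "Cod X (nabla_unit A) = !\<^sub>o A"
  using assms by (simp_all add: nabla_unit_def)

lemma nabla_unit_eps:
  assumes "A \<in> Ob X"
  shows "nabla_unit A \<cdot> \<epsilon> A = \<zero> \<K> A"
  using assms by (simp add: nabla_unit_def eps_nat)

lemma nabla_unit_e:
  assumes "A \<in> Ob X"
  shows "nabla_unit A \<cdot> \<e> A = \<one> \<K>"
  using assms by (simp add: nabla_unit_def e_nat mK_e)

lemma nabla_unit_Delta:
  assumes "A \<in> Ob X"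
  shows "nabla_unit A \<cdot> \<Delta> A = nabla_unit A \<otimes>\<^sub>m nabla_unit A"
  using assms by (simp add: nabla_unit_def Delta_nat comp_eq_tail[OF mK_Delta] inter)

lemma nabla_unit_nat:
  assumes "f \<in> Ar X" "Dom X f = A"
  shows "nabla_unit A \<cdot> !\<^sub>m f = nabla_unit (Cod X f)"
  using assms by (auto simp add: nabla_unit_def simp flip: bang_comp)

lemma nabla_unit_delta:
  assumes "A \<in> Ob X"
  shows "nabla_unit A \<cdot> \<delta> A = \<m>\<^sub>K \<cdot> !\<^sub>m (nabla_unit A)"
  using assms by (simp add: nabla_unit_def delta_nat comp_eq_tail[OF mK_delta] bang_comp)

lemma nabla_eq: "\<nabla> A = cotens A A \<cdot> !\<^sub>m (\<epsilon> A \<otimes>\<^sub>m \<e> A \<^bold>+ \<e> A \<otimes>\<^sub>m \<epsilon> A)" if "A \<in> Ob X"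
  using that by (simp add: nabla_def cotens_def)

lemma nabla_typing [simp]:
  assumes "A \<in> Ob X"
  shows "\<nabla> A \<in> Ar X" "Dom X (\<nabla> A) = !\<^sub>o A \<otimes>\<^sub>o !\<^sub>o A" "Cod X (\<nabla> A) = !\<^sub>o A"
  using assms by (simp_all add: nabla_eq)

lemma nabla_eps:
  assumes "A \<in> Ob X"
  shows "\<nabla> A \<cdot> \<epsilon> A = \<epsilon> A \<otimes>\<^sub>m \<e> A \<^bold>+ \<e> A \<otimes>\<^sub>m \<epsilon> A"
  using assms by (simp add: nabla_eq eps_nat comp_eq_tail[OF cotens_eps])

lemma nabla_e:
  assumes "A \<in> Ob X"
  shows "\<nabla> A \<cdot> \<e> A = \<e> A \<otimes>\<^sub>m \<e> A"
  using assms by (simp add: nabla_eq e_nat cotens_e)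

lemma nabla_delta:
  assumes "A \<in> Ob X"
  shows "\<nabla> A \<cdot> \<delta> A = cotens A A \<cdot> !\<^sub>m (\<nabla> A)"
  using assms by (simp add: nabla_eq delta_nat comp_eq_tail[OF cotens_delta] bang_comp)

lemma nabla_Delta:
  assumes "A \<in> Ob X"
  shows "\<nabla> A \<cdot> \<Delta> A = Dup2 A A \<cdot> (\<nabla> A \<otimes>\<^sub>m \<nabla> A)"
  using assms by (simp add: nabla_eq Delta_nat comp_eq_tail[OF cotens_Delta] inter)

text \<open>A coalgebra morphism into a cofree coalgebra is determined by its composite with
  \<open>\<epsilon>\<close>. Accordingly the unit is moved under \<open>!\<close>, where only the
  linear part \<open>?s\<close> has to be computed.\<close>

lemma nabla_unit_right:
  assumes "A \<in> Ob X"
  shows "(\<one> (!\<^sub>o A) \<otimes>\<^sub>m nabla_unit A) \<cdot> \<nabla> A = \<one> (!\<^sub>o A)"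
proof -
  let ?s = "\<epsilon> A \<otimes>\<^sub>m \<e> A \<^bold>+ \<e> A \<otimes>\<^sub>m \<epsilon> A"
  have "(\<one> (!\<^sub>o A) \<otimes>\<^sub>m nabla_unit A) \<cdot> \<nabla> A =
    (\<delta> A \<otimes>\<^sub>m (nabla_unit A \<cdot> \<delta> A)) \<cdot> (\<m>\<^sub>\<otimes> (!\<^sub>o A) (!\<^sub>o A) \<cdot> !\<^sub>m ?s)"
    using assms by (simp add: nabla_def inter)
  \<comment> \<open>The factor \<open>\<one> \<K>\<close> must stay visible for interchange to split
    off \<open>\<m>\<^sub>K\<close>, hence the deletion of \<open>tens_unit_right\<close>.\<close>
  also have "\<dots> = ((\<delta> A \<otimes>\<^sub>m \<one> \<K>) \<cdot> (\<one> (!\<^sub>o (!\<^sub>o A)) \<otimes>\<^sub>m \<m>\<^sub>K)) \<cdot>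
      ((!\<^sub>m (\<one> (!\<^sub>o A)) \<otimes>\<^sub>m !\<^sub>m (nabla_unit A)) \<cdot> (\<m>\<^sub>\<otimes> (!\<^sub>o A) (!\<^sub>o A) \<cdot> !\<^sub>m ?s))"
    using assms by (simp add: inter nabla_unit_delta del: tens_unit_right)
  also have "\<dots> = \<delta> A \<cdot> ((\<one> (!\<^sub>o (!\<^sub>o A)) \<otimes>\<^sub>m \<m>\<^sub>K) \<cdot> (\<m>\<^sub>\<otimes> (!\<^sub>o A) \<K> \<cdot>
      !\<^sub>m ((\<one> (!\<^sub>o A) \<otimes>\<^sub>m nabla_unit A) \<cdot> ?s)))"
    using assms by (simp add: comp_eq_tail[OF m_nat] bang_comp del: bang_id)
  also have "\<dots> = \<delta> A \<cdot> !\<^sub>m ((\<one> (!\<^sub>o A) \<otimes>\<^sub>m nabla_unit A) \<cdot> ?s)"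
    using assms by (simp add: comp_eq_tail[OF m_unit_right])
  also have "\<dots> = \<one> (!\<^sub>o A)"
    using assms by (simp add: distrib inter nabla_unit_e nabla_unit_eps)
  finally show ?thesis .
qed

lemma cotens_sym:
  assumes "A \<in> Ob X" "B \<in> Ob X"
  shows "\<sigma> (!\<^sub>o A) (!\<^sub>o B) \<cdot> cotens B A = cotens A B \<cdot> !\<^sub>m (\<sigma> (!\<^sub>o A) (!\<^sub>o B))"
proof -
  have "\<sigma> (!\<^sub>o A) (!\<^sub>o B) \<cdot> cotens B A =
    (\<sigma> (!\<^sub>o A) (!\<^sub>o B) \<cdot> (\<delta> B \<otimes>\<^sub>m \<delta> A)) \<cdot> \<m>\<^sub>\<otimes> (!\<^sub>o B) (!\<^sub>o A)"
    using assms by (simp add: cotens_def)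
  also have "\<dots> = ((\<delta> A \<otimes>\<^sub>m \<delta> B) \<cdot> \<sigma> (!\<^sub>o (!\<^sub>o A)) (!\<^sub>o (!\<^sub>o B))) \<cdot> \<m>\<^sub>\<otimes> (!\<^sub>o B) (!\<^sub>o A)"
    using assms by (subst sym_nat) simp_all
  finally show ?thesis
    using assms by (simp add: m_sym cotens_def)
qed

lemma nabla_commute:
  assumes "A \<in> Ob X"
  shows "\<sigma> (!\<^sub>o A) (!\<^sub>o A) \<cdot> \<nabla> A = \<nabla> A"
proof -
  let ?s = "\<epsilon> A \<otimes>\<^sub>m \<e> A \<^bold>+ \<e> A \<otimes>\<^sub>m \<epsilon> A"
  have "\<sigma> (!\<^sub>o A) (!\<^sub>o A) \<cdot> ?s = (\<e> A \<otimes>\<^sub>m \<epsilon> A) \<cdot> \<sigma> \<K> A \<^bold>+ (\<epsilon> A \<otimes>\<^sub>m \<e> A) \<cdot> \<sigma> A \<K>"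
    using assms by (simp add: distrib sym_nat)
  also have "\<dots> = ?s"
    using assms plus_commute[of "\<epsilon> A \<otimes>\<^sub>m \<e> A" "!\<^sub>o A \<otimes>\<^sub>o !\<^sub>o A" A "\<e> A \<otimes>\<^sub>m \<epsilon> A"]
    by (simp add: sym_unit sym_unit_left Hom_iff)
  finally have "\<sigma> (!\<^sub>o A) (!\<^sub>o A) \<cdot> ?s = ?s" .
  then have "!\<^sub>m (\<sigma> (!\<^sub>o A) (!\<^sub>o A)) \<cdot> !\<^sub>m ?s = !\<^sub>m ?s"
    using assms by (simp flip: bang_comp)
  then show ?thesis
    using assms by (simp add: nabla_eq comp_eq_tail[OF cotens_sym])
qed

text \<open>Both sides are the coalgebra structure on a triple tensor; \<open>m_assoc\<close>
  relates the two bracketings.\<close>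

lemma cotens_assoc:
  assumes "A \<in> Ob X" "B \<in> Ob X" "C \<in> Ob X"
  shows "(cotens A B \<otimes>\<^sub>m \<delta> C) \<cdot> \<m>\<^sub>\<otimes> (!\<^sub>o A \<otimes>\<^sub>o !\<^sub>o B) (!\<^sub>o C) =
    (\<delta> A \<otimes>\<^sub>m cotens B C) \<cdot> \<m>\<^sub>\<otimes> (!\<^sub>o A) (!\<^sub>o B \<otimes>\<^sub>o !\<^sub>o C)"
proof -
  have "(cotens A B \<otimes>\<^sub>m \<delta> C) \<cdot> \<m>\<^sub>\<otimes> (!\<^sub>o A \<otimes>\<^sub>o !\<^sub>o B) (!\<^sub>o C) = (\<delta> A \<otimes>\<^sub>m (\<delta> B \<otimes>\<^sub>m \<delta> C)) \<cdot>
     ((\<m>\<^sub>\<otimes> (!\<^sub>o A) (!\<^sub>o B) \<otimes>\<^sub>m \<one> (!\<^sub>o (!\<^sub>o C))) \<cdot> \<m>\<^sub>\<otimes> (!\<^sub>o A \<otimes>\<^sub>o !\<^sub>o B) (!\<^sub>o C))"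
    using assms by (simp add: inter cotens_def)
  also have "\<dots> = (\<delta> A \<otimes>\<^sub>m cotens B C) \<cdot> \<m>\<^sub>\<otimes> (!\<^sub>o A) (!\<^sub>o B \<otimes>\<^sub>o !\<^sub>o C)"
    using assms by (simp add: m_assoc) (simp add: inter cotens_def)
  finally show ?thesis .
qed

lemma comp_nabla:
  assumes "f \<in> Ar X" "g \<in> Ar X" "Cod X f = !\<^sub>o A" "Cod X g = !\<^sub>o A" "A \<in> Ob X"
  shows "(f \<otimes>\<^sub>m g) \<cdot> \<nabla> A = ((f \<cdot> \<delta> A) \<otimes>\<^sub>m (g \<cdot> \<delta> A)) \<cdot>
    (\<m>\<^sub>\<otimes> (!\<^sub>o A) (!\<^sub>o A) \<cdot> !\<^sub>m (\<epsilon> A \<otimes>\<^sub>m \<e> A \<^bold>+ \<e> A \<otimes>\<^sub>m \<epsilon> A))"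
  using assms by (simp add: nabla_def inter)

text \<open>The two triple products are coalgebra morphisms out of the coalgebra of
  \<open>cotens_assoc\<close>, so they agree once their linear parts do; \<open>nabla_delta\<close>
  and naturality of \<open>\<m>\<^sub>\<otimes>\<close> bring the inner multiplication under
  \<open>!\<close>.\<close>

lemma nabla_assoc:
  assumes "A \<in> Ob X"
  shows "(\<nabla> A \<otimes>\<^sub>m \<one> (!\<^sub>o A)) \<cdot> \<nabla> A = (\<one> (!\<^sub>o A) \<otimes>\<^sub>m \<nabla> A) \<cdot> \<nabla> A"
proof -
  let ?s = "\<epsilon> A \<otimes>\<^sub>m \<e> A \<^bold>+ \<e> A \<otimes>\<^sub>m \<epsilon> A"
  have "(\<nabla> A \<otimes>\<^sub>m \<one> (!\<^sub>o A)) \<cdot> \<nabla> A = (cotens A A \<otimes>\<^sub>m \<delta> A) \<cdot>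
     ((!\<^sub>m (\<nabla> A) \<otimes>\<^sub>m !\<^sub>m (\<one> (!\<^sub>o A))) \<cdot> (\<m>\<^sub>\<otimes> (!\<^sub>o A) (!\<^sub>o A) \<cdot> !\<^sub>m ?s))"
    using assms by (simp add: comp_nabla inter nabla_delta)
  also have "\<dots> = (cotens A A \<otimes>\<^sub>m \<delta> A) \<cdot> (\<m>\<^sub>\<otimes> (!\<^sub>o A \<otimes>\<^sub>o !\<^sub>o A) (!\<^sub>o A) \<cdot>
      !\<^sub>m ((\<nabla> A \<otimes>\<^sub>m \<one> (!\<^sub>o A)) \<cdot> ?s))"
    using assms by (simp add: comp_eq_tail[OF m_nat] bang_comp del: bang_id)
  \<comment> \<open>Both linear parts are the sum of the three maps that apply
    \<open>\<epsilon> A\<close> to one factor and erase the other two.\<close>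
  also have "(\<nabla> A \<otimes>\<^sub>m \<one> (!\<^sub>o A)) \<cdot> ?s = (\<one> (!\<^sub>o A) \<otimes>\<^sub>m \<nabla> A) \<cdot> ?s"
    using assms by (simp add: distrib inter nabla_eps nabla_e) (simp add: plus_assoc Hom_iff)
  also have "(cotens A A \<otimes>\<^sub>m \<delta> A) \<cdot> (\<m>\<^sub>\<otimes> (!\<^sub>o A \<otimes>\<^sub>o !\<^sub>o A) (!\<^sub>o A) \<cdot> !\<^sub>m \<dots>) =
    (\<delta> A \<otimes>\<^sub>m cotens A A) \<cdot> (\<m>\<^sub>\<otimes> (!\<^sub>o A) (!\<^sub>o A \<otimes>\<^sub>o !\<^sub>o A) \<cdot> !\<^sub>m ((\<one> (!\<^sub>o A) \<otimes>\<^sub>m \<nabla> A) \<cdot> ?s))"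
    using assms by (simp add: comp_eq_tail[OF cotens_assoc])
  also have "\<dots> = (\<delta> A \<otimes>\<^sub>m cotens A A) \<cdot>
     ((!\<^sub>m (\<one> (!\<^sub>o A)) \<otimes>\<^sub>m !\<^sub>m (\<nabla> A)) \<cdot> (\<m>\<^sub>\<otimes> (!\<^sub>o A) (!\<^sub>o A) \<cdot> !\<^sub>m ?s))"
    using assms by (simp add: comp_eq_tail[OF m_nat] bang_comp del: bang_id)
  also have "\<dots> = (\<one> (!\<^sub>o A) \<otimes>\<^sub>m \<nabla> A) \<cdot> \<nabla> A"
    using assms by (simp add: comp_nabla inter nabla_delta)
  finally show ?thesis .
qed

text \<open>\<open>\<e> A \<cdot> \<zero> \<K> B\<close> and
  \<open>\<epsilon> A \<cdot> \<zero> A B\<close> are the same zero map; \<open>\<delta> A\<close>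
  followed by \<open>!\<close> of it gives the two sides.\<close>

lemma bang_zero:
  assumes "A \<in> Ob X" "B \<in> Ob X"
  shows "!\<^sub>m (\<zero> A B) = \<e> A \<cdot> nabla_unit B"
proof -
  have "\<e> A \<cdot> nabla_unit B = \<delta> A \<cdot> (!\<^sub>m (\<e> A) \<cdot> !\<^sub>m (\<zero> \<K> B))"
    using assms by (simp add: nabla_unit_def comp_eq_tail[OF delta_bang_e])
  also have "\<dots> = \<delta> A \<cdot> (!\<^sub>m (\<epsilon> A) \<cdot> !\<^sub>m (\<zero> A B))"
    using assms by (simp flip: bang_comp)
  also have "\<dots> = !\<^sub>m (\<zero> A B)"
    using assms by (simp add: comp_eq_tail[OF comonad_simps(2)])
  finally show ?thesis by simp
qed

end

section \<open>Comparison of the rules\<close>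

locale differential = additive_linear_category X
  for X :: "('o, 'm, 'z) lincat_scheme" (structure) +
  fixes d :: "'o \<Rightarrow> 'm"
  assumes natural_d: "natural_d d"
begin

lemma d_typing [simp]:
  assumes "A \<in> Ob X"
  shows "d A \<in> Ar X" "Dom X (d A) = !\<^sub>o A \<otimes>\<^sub>o A" "Cod X (d A) = !\<^sub>o A"
  using natural_d assms by (auto simp: natural_d_def natural_def Hom_iff)

lemma d_nat:
  "f \<in> Ar X \<Longrightarrow> Cod X f = B \<Longrightarrow> (!\<^sub>m f \<otimes>\<^sub>m f) \<cdot> d B = d (Dom X f) \<cdot> !\<^sub>m f"
  using natural_d HomI[of f] by (auto simp: natural_d_def natural_def)

lemma d_nat':
  assumes "f \<in> Ar X" "Dom X f = A"
  shows "d A \<cdot> !\<^sub>m f = (!\<^sub>m f \<otimes>\<^sub>m f) \<cdot> d (Cod X f)"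
  using assms d_nat by simp

lemma constant_rule: "constant_rule d"
proof -
  have "d A \<cdot> \<e> A = \<zero> (!\<^sub>o A \<otimes>\<^sub>o A) \<K>" if "A \<in> Ob X" for A
  proof -
    have "d A \<cdot> \<e> A = d A \<cdot> (!\<^sub>m (\<zero> A A) \<cdot> \<e> A)"
      using that by (simp add: e_nat)
    also have "\<dots> = ((!\<^sub>m (\<zero> A A) \<otimes>\<^sub>m \<zero> A A) \<cdot> d A) \<cdot> \<e> A"
      using that by (subst d_nat) simp_all
    finally show ?thesis using that by simp
  qed
  then show ?thesis by (simp add: constant_rule_def)
qed

text \<open>This is the codereliction: the derivative at the origin.\<close>

definition eta :: "'o \<Rightarrow> 'm"
  where "eta A = (nabla_unit A \<otimes>\<^sub>m \<one> A) \<cdot> d A"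

lemma eta_typing [simp]:
  assumes "A \<in> Ob X"
  shows "eta A \<in> Ar X" "Dom X (eta A) = A" "Cod X (eta A) = !\<^sub>o A"
  using assms by (simp_all add: eta_def)

lemma eta_e:
  assumes "A \<in> Ob X"
  shows "eta A \<cdot> \<e> A = \<zero> A \<K>"
  using assms constant_rule by (simp add: eta_def constant_rule_def)

lemma eta_nat:
  assumes "f \<in> Ar X" "Dom X f = A"
  shows "eta A \<cdot> !\<^sub>m f = f \<cdot> eta (Cod X f)"
proof -
  have "eta A \<cdot> !\<^sub>m f = (nabla_unit A \<otimes>\<^sub>m \<one> A) \<cdot> ((!\<^sub>m f \<otimes>\<^sub>m f) \<cdot> d (Cod X f))"
    using assms by (auto simp add: eta_def d_nat)
  also have "\<dots> = ((\<one> \<K> \<otimes>\<^sub>m f) \<cdot> (nabla_unit (Cod X f) \<otimes>\<^sub>m \<one> (Cod X f))) \<cdot> d (Cod X f)"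
    using assms by (auto simp add: inter nabla_unit_nat simp del: tens_unit_left)
  also have "\<dots> = f \<cdot> eta (Cod X f)"
    using assms by (auto simp add: eta_def)
  finally show ?thesis .
qed

lemma eta_eps:
  assumes "linear_rule d" "A \<in> Ob X"
  shows "eta A \<cdot> \<epsilon> A = \<one> A"
  using assms by (simp add: eta_def linear_rule_def inter nabla_unit_e)

text \<open>
  Here \<open>f + g : A \<rightarrow> !A \<otimes> !A\<close> plays the role of the diagonal: it composes to \<open>1\<close> with both projections
  \<open>p\<close> and \<open>q\<close>, so \<open>\<Delta> = !(f + g) \<Delta> (!p \<otimes> !q)\<close>, and \<open>\<eta> !(f + g) = f \<eta> + g \<eta>\<close> by naturality.
\<close>

lemma eta_Delta:
  assumes "linear_rule d" "A \<in> Ob X"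
  shows "eta A \<cdot> \<Delta> A = eta A \<otimes>\<^sub>m nabla_unit A \<^bold>+ nabla_unit A \<otimes>\<^sub>m eta A"
proof -
  let ?f = "eta A \<otimes>\<^sub>m nabla_unit A" and ?g = "nabla_unit A \<otimes>\<^sub>m eta A"
  let ?p = "\<epsilon> A \<otimes>\<^sub>m \<e> A" and ?q = "\<e> A \<otimes>\<^sub>m \<epsilon> A"
  let ?W = "!\<^sub>o A \<otimes>\<^sub>o !\<^sub>o A"
  let ?k = "\<Delta> ?W \<cdot> (!\<^sub>m ?p \<otimes>\<^sub>m !\<^sub>m ?q)"
  note [simp] = eta_e eta_eps[OF assms(1)] nabla_unit_e nabla_unit_eps
  have f: "?f \<cdot> ?p = \<one> A" "?f \<cdot> ?q = \<zero> A A" and g: "?g \<cdot> ?p = \<zero> A A" "?g \<cdot> ?q = \<one> A"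
    using assms by (simp_all add: inter)
  have k: "!\<^sub>m h \<cdot> ?k = \<Delta> A \<cdot> (!\<^sub>m (h \<cdot> ?p) \<otimes>\<^sub>m !\<^sub>m (h \<cdot> ?q))"
    if "h \<in> Ar X" "Dom X h = A" "Cod X h = ?W" for h
    using assms that by (simp add: comp_eq_tail[OF Delta_nat] inter bang_comp)
  have ek: "h \<cdot> (eta ?W \<cdot> ?k) = eta A \<cdot> (!\<^sub>m h \<cdot> ?k)"
    if "h \<in> Ar X" "Dom X h = A" "Cod X h = ?W" for h
    using assms that by (simp add: comp_eq_tail[OF eta_nat])
  have "eta A \<cdot> \<Delta> A = eta A \<cdot> (!\<^sub>m (?f \<^bold>+ ?g) \<cdot> ?k)"
    using assms by (subst k) (simp_all add: distrib f g)
  \<comment> \<open>\<open>!\<close> is not additive, but naturality of \<open>eta\<close> brings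
    the sum out in front, where composition distributes over it. The same naturality is then used
    backwards on each summand.\<close>
  also have "\<dots> = (?f \<^bold>+ ?g) \<cdot> (eta ?W \<cdot> ?k)"
    using assms by (subst ek) simp_all
  also have "\<dots> = ?f \<cdot> (eta ?W \<cdot> ?k) \<^bold>+ ?g \<cdot> (eta ?W \<cdot> ?k)"
    using assms by (subst distrib) simp_all
  also have "?f \<cdot> (eta ?W \<cdot> ?k) = eta A \<cdot> (\<Delta> A \<cdot> (\<one> (!\<^sub>o A) \<otimes>\<^sub>m (\<e> A \<cdot> nabla_unit A)))"
    using assms by (simp add: ek k f bang_zero del: assoc)
  also have "\<dots> = eta A \<cdot> ((\<Delta> A \<cdot> (\<one> (!\<^sub>o A) \<otimes>\<^sub>m \<e> A)) \<cdot> (\<one> (!\<^sub>o A) \<otimes>\<^sub>m nabla_unit A))"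
    using assms by (simp add: inter del: comonoid_simps)
  also have "\<dots> = (eta A \<otimes>\<^sub>m \<one> \<K>) \<cdot> (\<one> (!\<^sub>o A) \<otimes>\<^sub>m nabla_unit A)"
    using assms by simp
  also have "\<dots> = ?f"
    using assms by (simp add: inter del: tens_unit_right)
  also have "?g \<cdot> (eta ?W \<cdot> ?k) = eta A \<cdot> (\<Delta> A \<cdot> ((\<e> A \<cdot> nabla_unit A) \<otimes>\<^sub>m \<one> (!\<^sub>o A)))"
    using assms by (simp add: ek k g bang_zero del: assoc)
  also have "\<dots> = eta A \<cdot> ((\<Delta> A \<cdot> (\<e> A \<otimes>\<^sub>m \<one> (!\<^sub>o A))) \<cdot> (nabla_unit A \<otimes>\<^sub>m \<one> (!\<^sub>o A)))"
    using assms by (simp add: inter del: comonoid_simps)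
  also have "\<dots> = (\<one> \<K> \<otimes>\<^sub>m eta A) \<cdot> (nabla_unit A \<otimes>\<^sub>m \<one> (!\<^sub>o A))"
    using assms by simp
  also have "\<dots> = ?g"
    using assms by (simp add: inter del: tens_unit_left)
  finally show ?thesis .
qed

section \<open>The \<nabla>-rule and its consequences\<close>

text \<open>Insert \<open>nabla_unit A\<close> into the second factor of the rule: one side turns
  \<open>d A\<close> into \<open>eta A\<close>, the other loses its multiplication by the unit
  law.\<close>

lemma eta_nabla_of_nabla_rule:
  assumes "nabla_rule d" "A \<in> Ob X"
  shows "(\<one> (!\<^sub>o A) \<otimes>\<^sub>m eta A) \<cdot> \<nabla> A = d A"
proof -
  have "(\<one> (!\<^sub>o A) \<otimes>\<^sub>m eta A) \<cdot> \<nabla> A =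
    (\<one> (!\<^sub>o A) \<otimes>\<^sub>m (nabla_unit A \<otimes>\<^sub>m \<one> A)) \<cdot> ((\<one> (!\<^sub>o A) \<otimes>\<^sub>m d A) \<cdot> \<nabla> A)"
    using assms(2) by (simp add: eta_def inter)
  also have "(\<one> (!\<^sub>o A) \<otimes>\<^sub>m d A) \<cdot> \<nabla> A = (\<nabla> A \<otimes>\<^sub>m \<one> A) \<cdot> d A"
    using assms by (simp add: nabla_rule_def)
  also have "(\<one> (!\<^sub>o A) \<otimes>\<^sub>m (nabla_unit A \<otimes>\<^sub>m \<one> A)) \<cdot> \<dots> = d A"
    using assms(2) by (simp add: inter nabla_unit_right)
  finally show ?thesis .
qed

lemma nabla_rule_of_eta_nabla:
  assumes "\<And>A. A \<in> Ob X \<Longrightarrow> d A = (\<one> (!\<^sub>o A) \<otimes>\<^sub>m eta A) \<cdot> \<nabla> A"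
  shows "nabla_rule d"
proof -
  have "(\<nabla> A \<otimes>\<^sub>m \<one> A) \<cdot> d A = (\<one> (!\<^sub>o A) \<otimes>\<^sub>m d A) \<cdot> \<nabla> A" if "A \<in> Ob X" for A
  proof -
    have "(\<nabla> A \<otimes>\<^sub>m \<one> A) \<cdot> d A =
      (\<one> (!\<^sub>o A) \<otimes>\<^sub>m (\<one> (!\<^sub>o A) \<otimes>\<^sub>m eta A)) \<cdot> ((\<nabla> A \<otimes>\<^sub>m \<one> (!\<^sub>o A)) \<cdot> \<nabla> A)"
      using that by (simp add: assms inter)
    also have "\<dots> = (\<one> (!\<^sub>o A) \<otimes>\<^sub>m d A) \<cdot> \<nabla> A"
      using that by (simp add: nabla_assoc assms) (simp add: inter)
    finally show ?thesis .
  qed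
  then show ?thesis by (simp add: nabla_rule_def)
qed

lemma interchange_rule_of_nabla_rule:
  assumes "nabla_rule d"
  shows "interchange_rule d"
proof -
  have "(d A \<otimes>\<^sub>m \<one> A) \<cdot> d A = (\<one> (!\<^sub>o A) \<otimes>\<^sub>m \<sigma> A A) \<cdot> ((d A \<otimes>\<^sub>m \<one> A) \<cdot> d A)" if "A \<in> Ob X" for A
  proof -
    let ?e = "\<one> (!\<^sub>o A) \<otimes>\<^sub>m (eta A \<otimes>\<^sub>m eta A)"
    note d = eta_nabla_of_nabla_rule[OF assms that, symmetric]
    \<comment> \<open>Two derivatives are two multiplications by \<open>eta A\<close>. Regrouped by
      associativity, the two directions meet in one product, where commutativity absorbs their
      swap.\<close>
    have dd: "(d A \<otimes>\<^sub>m \<one> A) \<cdot> d A = ?e \<cdot> ((\<one> (!\<^sub>o A) \<otimes>\<^sub>m \<nabla> A) \<cdot> \<nabla> A)"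
      using that by (simp add: d inter flip: nabla_assoc)
    have "(\<one> (!\<^sub>o A) \<otimes>\<^sub>m \<sigma> A A) \<cdot> (?e \<cdot> ((\<one> (!\<^sub>o A) \<otimes>\<^sub>m \<nabla> A) \<cdot> \<nabla> A)) =
      ?e \<cdot> ((\<one> (!\<^sub>o A) \<otimes>\<^sub>m (\<sigma> (!\<^sub>o A) (!\<^sub>o A) \<cdot> \<nabla> A)) \<cdot> \<nabla> A)"
      using that by (simp add: inter comp_eq_tail[OF sym_nat] del: nabla_commute)
    then show ?thesis
      using that by (simp add: dd nabla_commute)
  qed
  then show ?thesis by (simp add: interchange_rule_def)
qed

lemma product_rule_of_nabla_rule:
  assumes "linear_rule d" "nabla_rule d"
  shows "product_rule d"
proof -
  have "d A \<cdot> \<Delta> A = (\<Delta> A \<otimes>\<^sub>m \<one> A) \<cdot>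
        (\<one> (!\<^sub>o A) \<otimes>\<^sub>m d A \<^bold>+ (\<one> (!\<^sub>o A) \<otimes>\<^sub>m \<sigma> (!\<^sub>o A) A) \<cdot> (d A \<otimes>\<^sub>m \<one> (!\<^sub>o A)))"
    if A: "A \<in> Ob X" for A
  proof -
    let ?I = "\<one> (!\<^sub>o A)"
    note d = eta_nabla_of_nabla_rule[OF assms(2) A]
    \<comment> \<open>Stated for arbitrary \<open>f\<close> and \<open>g\<close> so as to serve both
      summands of \<open>eta_Delta\<close>, in which \<open>eta A\<close> and
      \<open>nabla_unit A\<close> trade places.\<close>
    have *: "(\<Delta> A \<otimes>\<^sub>m (f \<otimes>\<^sub>m g)) \<cdot> (middle_swap (!\<^sub>o A) (!\<^sub>o A) (!\<^sub>o A) (!\<^sub>o A) \<cdot> (\<nabla> A \<otimes>\<^sub>m \<nabla> A)) =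
      (\<Delta> A \<otimes>\<^sub>m (\<one> (Dom X f) \<otimes>\<^sub>m \<one> (Dom X g))) \<cdot> (middle_swap (!\<^sub>o A) (!\<^sub>o A) (Dom X f) (Dom X g) \<cdot>
       (((?I \<otimes>\<^sub>m f) \<cdot> \<nabla> A) \<otimes>\<^sub>m ((?I \<otimes>\<^sub>m g) \<cdot> \<nabla> A)))"
      if "f \<in> Ar X" "g \<in> Ar X" "Cod X f = !\<^sub>o A" "Cod X g = !\<^sub>o A" for f g
    proof -
      have "(\<Delta> A \<otimes>\<^sub>m (f \<otimes>\<^sub>m g)) \<cdot> (middle_swap (!\<^sub>o A) (!\<^sub>o A) (!\<^sub>o A) (!\<^sub>o A) \<cdot> (\<nabla> A \<otimes>\<^sub>m \<nabla> A)) =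
        (\<Delta> A \<otimes>\<^sub>m (\<one> (Dom X f) \<otimes>\<^sub>m \<one> (Dom X g))) \<cdot>
        ((?I \<otimes>\<^sub>m (?I \<otimes>\<^sub>m (f \<otimes>\<^sub>m g))) \<cdot> (middle_swap (!\<^sub>o A) (!\<^sub>o A) (!\<^sub>o A) (!\<^sub>o A) \<cdot> (\<nabla> A \<otimes>\<^sub>m \<nabla> A)))"
        using that A by (simp add: inter)
      also have "(?I \<otimes>\<^sub>m (?I \<otimes>\<^sub>m (f \<otimes>\<^sub>m g))) \<cdot> (middle_swap (!\<^sub>o A) (!\<^sub>o A) (!\<^sub>o A) (!\<^sub>o A) \<cdot> (\<nabla> A \<otimes>\<^sub>m \<nabla> A)) =
        middle_swap (!\<^sub>o A) (!\<^sub>o A) (Dom X f) (Dom X g) \<cdot>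
         (((?I \<otimes>\<^sub>m f) \<cdot> \<nabla> A) \<otimes>\<^sub>m ((?I \<otimes>\<^sub>m g) \<cdot> \<nabla> A))"
        using that A by (simp add: comp_eq_tail[OF middle_swap_nat]) (simp add: inter)
      finally show ?thesis .
    qed
    have "d A \<cdot> \<Delta> A = (\<Delta> A \<otimes>\<^sub>m (eta A \<otimes>\<^sub>m nabla_unit A \<^bold>+ nabla_unit A \<otimes>\<^sub>m eta A)) \<cdot>
       (middle_swap (!\<^sub>o A) (!\<^sub>o A) (!\<^sub>o A) (!\<^sub>o A) \<cdot> (\<nabla> A \<otimes>\<^sub>m \<nabla> A))"
      using A by (simp add: d[symmetric] nabla_Delta) (simp add: Dup2_def inter eta_Delta[OF assms(1)])
    also have "\<dots> = (\<Delta> A \<otimes>\<^sub>m (eta A \<otimes>\<^sub>m nabla_unit A)) \<cdot>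
       (middle_swap (!\<^sub>o A) (!\<^sub>o A) (!\<^sub>o A) (!\<^sub>o A) \<cdot> (\<nabla> A \<otimes>\<^sub>m \<nabla> A)) \<^bold>+
       (\<Delta> A \<otimes>\<^sub>m (nabla_unit A \<otimes>\<^sub>m eta A)) \<cdot>
       (middle_swap (!\<^sub>o A) (!\<^sub>o A) (!\<^sub>o A) (!\<^sub>o A) \<cdot> (\<nabla> A \<otimes>\<^sub>m \<nabla> A))"
      using A by (simp add: distrib)
    \<comment> \<open>\<open>nabla_unit A\<close> has domain \<open>\<K>\<close>: in the first
      summand the middle swap shrinks to the symmetry of the product rule, in the second it is an
      identity.\<close>
    also have "\<dots> = (\<Delta> A \<otimes>\<^sub>m \<one> A) \<cdot> ((?I \<otimes>\<^sub>m \<sigma> (!\<^sub>o A) A) \<cdot> (d A \<otimes>\<^sub>m ?I)) \<^bold>+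
        (\<Delta> A \<otimes>\<^sub>m \<one> A) \<cdot> (?I \<otimes>\<^sub>m d A)"
      using A by (simp add: * d nabla_unit_right) (simp add: middle_swap_def sym_unit)
    finally show ?thesis
      using A plus_commute[of "(\<Delta> A \<otimes>\<^sub>m \<one> A) \<cdot> (?I \<otimes>\<^sub>m d A)" "!\<^sub>o A \<otimes>\<^sub>o A" "!\<^sub>o A \<otimes>\<^sub>o !\<^sub>o A"
       "(\<Delta> A \<otimes>\<^sub>m \<one> A) \<cdot> ((?I \<otimes>\<^sub>m \<sigma> (!\<^sub>o A) A) \<cdot> (d A \<otimes>\<^sub>m ?I))"]
      by (simp add: distrib Hom_iff)
  qed
  then show ?thesis by (simp add: product_rule_def)
qed

section \<open>From the product rule to the monoidal rule\<close>

lemma Delta_slide: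
  assumes "v \<in> Ar X" "Dom X v = V" "Cod X v = W" "h \<in> Ar X" "Dom X h = !\<^sub>o W \<otimes>\<^sub>o (!\<^sub>o W \<otimes>\<^sub>o W)"
  shows "(\<one> (!\<^sub>o W) \<otimes>\<^sub>m v) \<cdot> ((\<Delta> W \<otimes>\<^sub>m \<one> W) \<cdot> h) =
    (\<Delta> W \<otimes>\<^sub>m \<one> V) \<cdot> ((\<one> (!\<^sub>o W) \<otimes>\<^sub>m (\<one> (!\<^sub>o W) \<otimes>\<^sub>m v)) \<cdot> h)"
proof -
  have "W \<in> Ob X" "V \<in> Ob X" using assms by auto
  then show ?thesis using assms by (simp add: inter)
qed

text \<open>Along a direction in which \<open>a\<close> has derivative \<open>0\<close>, only one summand of the product rule survives.\<close>

lemma product_rule_direction: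
  assumes "product_rule d" "v \<in> Ar X" "Dom X v = V" "Cod X v = W"
    "a \<in> Ar X" "Dom X a = !\<^sub>o W" "b \<in> Ar X" "Dom X b = !\<^sub>o W"
    "(\<one> (!\<^sub>o W) \<otimes>\<^sub>m v) \<cdot> (d W \<cdot> a) = \<zero> (!\<^sub>o W \<otimes>\<^sub>o V) (Cod X a)"
  shows "(\<one> (!\<^sub>o W) \<otimes>\<^sub>m v) \<cdot> (d W \<cdot> (\<Delta> W \<cdot> (a \<otimes>\<^sub>m b))) =
    (\<Delta> W \<otimes>\<^sub>m \<one> V) \<cdot> (a \<otimes>\<^sub>m ((\<one> (!\<^sub>o W) \<otimes>\<^sub>m v) \<cdot> (d W \<cdot> b)))"
proof -
  let ?I = "\<one> (!\<^sub>o W)"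
  let ?x = "(?I \<otimes>\<^sub>m d W) \<cdot> (a \<otimes>\<^sub>m b)"
  let ?y = "(?I \<otimes>\<^sub>m \<sigma> (!\<^sub>o W) W) \<cdot> ((d W \<otimes>\<^sub>m ?I) \<cdot> (a \<otimes>\<^sub>m b))"
  have ob [simp]: "W \<in> Ob X" "V \<in> Ob X" using assms by auto
  note [simp] = assms(2-8)
  have "(?I \<otimes>\<^sub>m v) \<cdot> (d W \<cdot> (\<Delta> W \<cdot> (a \<otimes>\<^sub>m b))) = (?I \<otimes>\<^sub>m v) \<cdot> ((\<Delta> W \<otimes>\<^sub>m \<one> W) \<cdot>
     ((?I \<otimes>\<^sub>m d W \<^bold>+ (?I \<otimes>\<^sub>m \<sigma> (!\<^sub>o W) W) \<cdot> (d W \<otimes>\<^sub>m ?I)) \<cdot> (a \<otimes>\<^sub>m b)))"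
    using assms(1) ob by (subst comp_eq_tail[of "d W" "\<Delta> W"]) (auto simp: product_rule_def)
  also have "(?I \<otimes>\<^sub>m d W \<^bold>+ (?I \<otimes>\<^sub>m \<sigma> (!\<^sub>o W) W) \<cdot> (d W \<otimes>\<^sub>m ?I)) \<cdot> (a \<otimes>\<^sub>m b) = ?x \<^bold>+ ?y"
    by (simp add: distrib)
  also have "(?I \<otimes>\<^sub>m v) \<cdot> ((\<Delta> W \<otimes>\<^sub>m \<one> W) \<cdot> (?x \<^bold>+ ?y)) =
    (\<Delta> W \<otimes>\<^sub>m \<one> V) \<cdot> ((?I \<otimes>\<^sub>m (?I \<otimes>\<^sub>m v)) \<cdot> (?x \<^bold>+ ?y))"
    by (rule Delta_slide) simp_all
  also have "(?I \<otimes>\<^sub>m (?I \<otimes>\<^sub>m v)) \<cdot> (?x \<^bold>+ ?y) =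
    (?I \<otimes>\<^sub>m (?I \<otimes>\<^sub>m v)) \<cdot> ?x \<^bold>+ (?I \<otimes>\<^sub>m (?I \<otimes>\<^sub>m v)) \<cdot> ?y"
    by (subst distrib) simp_all
  also have "(?I \<otimes>\<^sub>m (?I \<otimes>\<^sub>m v)) \<cdot> ?x = a \<otimes>\<^sub>m ((?I \<otimes>\<^sub>m v) \<cdot> (d W \<cdot> b))"
    by (simp add: inter)
  also have "(?I \<otimes>\<^sub>m (?I \<otimes>\<^sub>m v)) \<cdot> ?y =
    (?I \<otimes>\<^sub>m ((?I \<otimes>\<^sub>m v) \<cdot> \<sigma> (!\<^sub>o W) W)) \<cdot> ((d W \<cdot> a) \<otimes>\<^sub>m b)"
    by (simp add: inter)
  \<comment> \<open>Naturality of the symmetry carries \<open>v\<close> past the second copy of the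
    point, next to the \<open>d W\<close> that is followed by \<open>a\<close>; there the hypothesis
    on \<open>a\<close> gives zero.\<close>
  also have "(?I \<otimes>\<^sub>m ((?I \<otimes>\<^sub>m v) \<cdot> \<sigma> (!\<^sub>o W) W)) \<cdot> ((d W \<cdot> a) \<otimes>\<^sub>m b) =
    (?I \<otimes>\<^sub>m \<sigma> (!\<^sub>o W) V) \<cdot> ((?I \<otimes>\<^sub>m (v \<otimes>\<^sub>m ?I)) \<cdot> ((d W \<cdot> a) \<otimes>\<^sub>m b))"
    by (simp add: sym_nat interchange_tail)
  also have "(?I \<otimes>\<^sub>m (v \<otimes>\<^sub>m ?I)) \<cdot> ((d W \<cdot> a) \<otimes>\<^sub>m b) = \<zero> (!\<^sub>o W \<otimes>\<^sub>o V) (Cod X a) \<otimes>\<^sub>m b"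
    by (simp add: inter assms(9))
  finally show ?thesis by simp
qed

lemma monoidal_rule_of_product_rule:
  assumes P: "product_rule d" and L: "linear_rule d" and C: "chain_rule d"
  shows "monoidal_rule d"
  unfolding monoidal_rule_def
proof (intro ballI)
  fix A B assume [simp]: "A \<in> Ob X" "B \<in> Ob X"
  define W where "W = !\<^sub>o A \<otimes>\<^sub>o !\<^sub>o B"
  define p where "p = \<epsilon> A \<otimes>\<^sub>m \<e> B"
  define q where "q = \<e> A \<otimes>\<^sub>m \<epsilon> B"
  define v where "v = nabla_unit A \<otimes>\<^sub>m eta B"
  define c where "c = cotens A B"
  \<comment> \<open>\<open>g\<close> extends \<open>\<m>\<^sub>\<otimes> A B\<close> along
    \<open>c\<close> (see \<open>cg\<close>). Being a coalgebra morphism, it is the cofree extension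
    of its linear part \<open>r\<close>, which makes the chain rule applicable to it.\<close>
  define g where "g = \<Delta> W \<cdot> ((!\<^sub>m p \<otimes>\<^sub>m !\<^sub>m q) \<cdot> \<m>\<^sub>\<otimes> A B)"
  define r where "r = \<Delta> W \<cdot> ((\<epsilon> W \<cdot> p) \<otimes>\<^sub>m (\<epsilon> W \<cdot> q))"
  let ?I = "\<one> (!\<^sub>o W)"
  have [simp]: "W \<in> Ob X" by (simp add: W_def)
  have [simp]: "p \<in> Ar X" "Dom X p = W" "Cod X p = A" "q \<in> Ar X" "Dom X q = W" "Cod X q = B"
    "v \<in> Ar X" "Dom X v = B" "Cod X v = W"
    "c \<in> Ar X" "Dom X c = W" "Cod X c = !\<^sub>o W"
    by (simp_all add: W_def p_def q_def v_def c_def)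
  have [simp]: "g \<in> Ar X" "Dom X g = !\<^sub>o W" "Cod X g = !\<^sub>o (A \<otimes>\<^sub>o B)"
    "r \<in> Ar X" "Dom X r = !\<^sub>o W" "Cod X r = A \<otimes>\<^sub>o B"
    by (simp_all add: g_def r_def)
  have vp: "v \<cdot> p = \<zero> B A" and vq: "v \<cdot> q = \<one> B"
    by (simp_all add: v_def p_def q_def inter nabla_unit_e nabla_unit_eps eta_e eta_eps[OF L])
  have g_delta: "g \<cdot> \<delta> (A \<otimes>\<^sub>o B) = \<delta> W \<cdot> !\<^sub>m g"
  proof -
    have "g \<cdot> \<delta> (A \<otimes>\<^sub>o B) = \<Delta> W \<cdot> (((!\<^sub>m p \<cdot> \<delta> A) \<otimes>\<^sub>m (!\<^sub>m q \<cdot> \<delta> B)) \<cdot>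
        (\<m>\<^sub>\<otimes> (!\<^sub>o A) (!\<^sub>o B) \<cdot> !\<^sub>m (\<m>\<^sub>\<otimes> A B)))"
      by (simp add: g_def m_delta) (simp add: inter)
    also have "\<dots> = (\<Delta> W \<cdot> (\<delta> W \<otimes>\<^sub>m \<delta> W)) \<cdot> ((!\<^sub>m (!\<^sub>m p) \<otimes>\<^sub>m !\<^sub>m (!\<^sub>m q)) \<cdot>
        (\<m>\<^sub>\<otimes> (!\<^sub>o A) (!\<^sub>o B) \<cdot> !\<^sub>m (\<m>\<^sub>\<otimes> A B)))"
      by (simp add: delta_nat) (simp add: inter)
    also have "\<dots> = (\<Delta> W \<cdot> ((\<delta> W \<otimes>\<^sub>m \<delta> W) \<cdot> \<m>\<^sub>\<otimes> (!\<^sub>o W) (!\<^sub>o W))) \<cdot> (!\<^sub>m (!\<^sub>m p \<otimes>\<^sub>m !\<^sub>m q) \<cdot> !\<^sub>m (\<m>\<^sub>\<otimes> A B))"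
      by (simp add: comp_eq_tail[OF m_nat])
    also have "\<dots> = (\<delta> W \<cdot> !\<^sub>m (\<Delta> W)) \<cdot> (!\<^sub>m (!\<^sub>m p \<otimes>\<^sub>m !\<^sub>m q) \<cdot> !\<^sub>m (\<m>\<^sub>\<otimes> A B))"
      by (simp add: delta_bang_Delta del: assoc) simp
    finally show ?thesis by (simp add: g_def bang_comp)
  qed
  have "g \<cdot> \<epsilon> (A \<otimes>\<^sub>o B) = r"
    by (simp add: g_def r_def m_eps inter eps_nat)
  \<comment> \<open>The counit law recovers \<open>g\<close> from \<open>g\<close> followed by
    \<open>\<delta>\<close>; with \<open>g_delta\<close>, the \<open>\<epsilon>\<close> moves under
    \<open>!\<close> and turns \<open>g\<close> there into \<open>r\<close>.\<close>
  moreover have "g = (g \<cdot> \<delta> (A \<otimes>\<^sub>o B)) \<cdot> !\<^sub>m (\<epsilon> (A \<otimes>\<^sub>o B))" by simp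
  ultimately have g: "g = \<delta> W \<cdot> !\<^sub>m r"
    by (simp add: g_delta flip: bang_comp)
  have cg: "c \<cdot> g = \<m>\<^sub>\<otimes> A B"
  proof -
    have "c \<cdot> g = (c \<cdot> (\<Delta> W \<cdot> (!\<^sub>m p \<otimes>\<^sub>m !\<^sub>m q))) \<cdot> \<m>\<^sub>\<otimes> A B" by (simp add: g_def)
    also have "c \<cdot> (\<Delta> W \<cdot> (!\<^sub>m p \<otimes>\<^sub>m !\<^sub>m q)) = \<one> W"
      unfolding c_def W_def p_def q_def by (rule cotens_pair) simp_all
    finally show ?thesis by (simp add: W_def)
  qed
  have dq: "(?I \<otimes>\<^sub>m v) \<cdot> (d W \<cdot> !\<^sub>m q) = (!\<^sub>m q \<otimes>\<^sub>m \<one> B) \<cdot> d B"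
    by (simp add: d_nat') (simp add: inter vq)
  have dp: "(?I \<otimes>\<^sub>m v) \<cdot> (d W \<cdot> !\<^sub>m p) = \<zero> (!\<^sub>o W \<otimes>\<^sub>o B) (!\<^sub>o A)"
    by (simp add: d_nat') (simp add: inter vp)
  have lin: "(?I \<otimes>\<^sub>m v) \<cdot> (d W \<cdot> (\<epsilon> W \<cdot> f)) = \<e> W \<otimes>\<^sub>m (v \<cdot> f)"
    if "f \<in> Ar X" "Dom X f = W" for f
  proof -
    have "d W \<cdot> (\<epsilon> W \<cdot> f) = (\<e> W \<otimes>\<^sub>m \<one> W) \<cdot> (\<one> \<K> \<otimes>\<^sub>m f)"
      using that L by (subst comp_eq_tail[of "d W" "\<epsilon> W"]) (auto simp: linear_rule_def)
    also have "\<dots> = \<e> W \<otimes>\<^sub>m f"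
      using that by (simp add: inter del: tens_unit_left)
    finally show ?thesis using that by (simp add: inter)
  qed
  \<comment> \<open>By the linear rule, \<open>\<epsilon> W \<cdot> p\<close> has derivative zero
    along \<open>v\<close> and \<open>\<epsilon> W \<cdot> q\<close> has derivative
    \<open>\<e> W \<otimes>\<^sub>m \<one> B\<close>; the erasure then cancels the
    duplication.\<close>
  have "(?I \<otimes>\<^sub>m v) \<cdot> (d W \<cdot> r) = (\<Delta> W \<otimes>\<^sub>m \<one> B) \<cdot> ((\<epsilon> W \<cdot> p) \<otimes>\<^sub>m (\<e> W \<otimes>\<^sub>m \<one> B))"
    unfolding r_def by (subst product_rule_direction[OF P]) (simp_all add: lin vp vq)
  also have "\<dots> = ((\<Delta> W \<cdot> (\<one> (!\<^sub>o W) \<otimes>\<^sub>m \<e> W)) \<cdot> (\<epsilon> W \<cdot> p)) \<otimes>\<^sub>m \<one> B"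
  proof -
    have "(\<epsilon> W \<cdot> p) \<otimes>\<^sub>m \<e> W = (\<one> (!\<^sub>o W) \<otimes>\<^sub>m \<e> W) \<cdot> ((\<epsilon> W \<cdot> p) \<otimes>\<^sub>m \<one> \<K>)"
      by (simp add: inter del: tens_unit_right)
    then show ?thesis by (simp add: inter del: comonoid_simps)
  qed
  finally have dr: "(?I \<otimes>\<^sub>m v) \<cdot> (d W \<cdot> r) = (\<epsilon> W \<cdot> p) \<otimes>\<^sub>m \<one> B" by simp
  \<comment> \<open>First computation of the derivative of \<open>g\<close> along \<open>v\<close>,
    by the product rule.\<close>
  have "(?I \<otimes>\<^sub>m v) \<cdot> (d W \<cdot> g) = ((?I \<otimes>\<^sub>m v) \<cdot> (d W \<cdot> (\<Delta> W \<cdot> (!\<^sub>m p \<otimes>\<^sub>m !\<^sub>m q)))) \<cdot> \<m>\<^sub>\<otimes> A B"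
    by (simp add: g_def)
  also have "\<dots> = (\<Delta> W \<otimes>\<^sub>m \<one> B) \<cdot> ((!\<^sub>m p \<otimes>\<^sub>m ((!\<^sub>m q \<otimes>\<^sub>m \<one> B) \<cdot> d B)) \<cdot> \<m>\<^sub>\<otimes> A B)"
    by (subst product_rule_direction[OF P, of v B W]) (simp_all add: dp dq)
  finally have 1: "(?I \<otimes>\<^sub>m v) \<cdot> (d W \<cdot> g) = \<dots>" .
  \<comment> \<open>Second computation, by the chain rule applied to
    \<open>g = \<delta> W \<cdot> !\<^sub>m r\<close>.\<close>
  have "d W \<cdot> g = (\<Delta> W \<otimes>\<^sub>m \<one> W) \<cdot> ((\<delta> W \<otimes>\<^sub>m d W) \<cdot> (d (!\<^sub>o W) \<cdot> !\<^sub>m r))"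
    using C unfolding g by (subst comp_eq_tail[of "d W" "\<delta> W"]) (auto simp: chain_rule_def)
  also have "\<dots> = (\<Delta> W \<otimes>\<^sub>m \<one> W) \<cdot> ((g \<otimes>\<^sub>m (d W \<cdot> r)) \<cdot> d (A \<otimes>\<^sub>o B))"
    by (simp add: d_nat') (simp add: inter g)
  finally have "(?I \<otimes>\<^sub>m v) \<cdot> (d W \<cdot> g) =
    (\<Delta> W \<otimes>\<^sub>m \<one> B) \<cdot> ((g \<otimes>\<^sub>m ((?I \<otimes>\<^sub>m v) \<cdot> (d W \<cdot> r))) \<cdot> d (A \<otimes>\<^sub>o B))"
    by (simp add: Delta_slide) (simp add: inter)
  then have 2: "(\<Delta> W \<otimes>\<^sub>m \<one> B) \<cdot> ((!\<^sub>m p \<otimes>\<^sub>m ((!\<^sub>m q \<otimes>\<^sub>m \<one> B) \<cdot> d B)) \<cdot> \<m>\<^sub>\<otimes> A B) =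
    (\<Delta> W \<otimes>\<^sub>m \<one> B) \<cdot> ((g \<otimes>\<^sub>m ((\<epsilon> W \<cdot> p) \<otimes>\<^sub>m \<one> B)) \<cdot> d (A \<otimes>\<^sub>o B))"
    by (simp only: dr 1)
  have Dup [simp]: "Dup2 A B \<in> Ar X" "Dom X (Dup2 A B) = W" "Cod X (Dup2 A B) = W \<otimes>\<^sub>o W"
    by (simp_all add: W_def)
  have cD: "c \<cdot> \<Delta> W = Dup2 A B \<cdot> (c \<otimes>\<^sub>m c)"
    by (simp add: c_def W_def cotens_Delta)
  \<comment> \<open>Both results are now restricted along \<open>c\<close>, which replaces
    duplication on \<open>!\<^sub>o W\<close> by \<open>Dup2\<close>.\<close>
  have cs: "(c \<otimes>\<^sub>m \<one> B) \<cdot> ((\<Delta> W \<otimes>\<^sub>m \<one> B) \<cdot> h) = (Dup2 A B \<otimes>\<^sub>m \<one> B) \<cdot> ((c \<otimes>\<^sub>m (c \<otimes>\<^sub>m \<one> B)) \<cdot> h)"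
    if "h \<in> Ar X" "Dom X h = !\<^sub>o W \<otimes>\<^sub>o (!\<^sub>o W \<otimes>\<^sub>o B)" for h
  proof -
    have "(c \<otimes>\<^sub>m \<one> B) \<cdot> ((\<Delta> W \<otimes>\<^sub>m \<one> B) \<cdot> h) = ((Dup2 A B \<cdot> (c \<otimes>\<^sub>m c)) \<otimes>\<^sub>m \<one> B) \<cdot> h"
      using that by (subst whisker_comp_tail) (simp_all add: cD)
    also have "\<dots> = (Dup2 A B \<otimes>\<^sub>m \<one> B) \<cdot> (((c \<otimes>\<^sub>m c) \<otimes>\<^sub>m \<one> B) \<cdot> h)"
      using that by (subst whisker_comp_tail) simp_all
    finally show ?thesis by simp
  qed
  have "(c \<otimes>\<^sub>m \<one> B) \<cdot> ((\<Delta> W \<otimes>\<^sub>m \<one> B) \<cdot> ((!\<^sub>m p \<otimes>\<^sub>m ((!\<^sub>m q \<otimes>\<^sub>m \<one> B) \<cdot> d B)) \<cdot> \<m>\<^sub>\<otimes> A B)) =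
    (Dup2 A B \<otimes>\<^sub>m \<one> B) \<cdot> (((c \<cdot> !\<^sub>m p) \<otimes>\<^sub>m (((c \<cdot> !\<^sub>m q) \<otimes>\<^sub>m \<one> B) \<cdot> d B)) \<cdot> \<m>\<^sub>\<otimes> A B)"
    by (simp add: cs) (simp add: inter)
  \<comment> \<open>Restriction turns \<open>!\<^sub>m p\<close> and \<open>!\<^sub>m q\<close> into
    erasures of the opposite factors, which cancel \<open>Dup2\<close>.\<close>
  also have "\<dots> = (Dup2 A B \<otimes>\<^sub>m \<one> B) \<cdot>
    (((\<one> (!\<^sub>o A) \<otimes>\<^sub>m (\<e> B \<otimes>\<^sub>m (\<e> A \<otimes>\<^sub>m \<one> (!\<^sub>o B)))) \<otimes>\<^sub>m \<one> B) \<cdot> ((\<one> (!\<^sub>o A) \<otimes>\<^sub>m d B) \<cdot> \<m>\<^sub>\<otimes> A B))"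
    by (simp add: c_def p_def q_def W_def cotens_fst cotens_snd inter scalar_tensor_comp)
  also have "\<dots> = (\<one> (!\<^sub>o A) \<otimes>\<^sub>m d B) \<cdot> \<m>\<^sub>\<otimes> A B"
    by (subst whisker_comp_tail) (simp_all add: Dup2_counit W_def)
  finally have 3: "(c \<otimes>\<^sub>m \<one> B) \<cdot> ((\<Delta> W \<otimes>\<^sub>m \<one> B) \<cdot> ((!\<^sub>m p \<otimes>\<^sub>m ((!\<^sub>m q \<otimes>\<^sub>m \<one> B) \<cdot> d B)) \<cdot> \<m>\<^sub>\<otimes> A B)) =
    (\<one> (!\<^sub>o A) \<otimes>\<^sub>m d B) \<cdot> \<m>\<^sub>\<otimes> A B" .
  have "(c \<otimes>\<^sub>m \<one> B) \<cdot> ((\<Delta> W \<otimes>\<^sub>m \<one> B) \<cdot> ((g \<otimes>\<^sub>m ((\<epsilon> W \<cdot> p) \<otimes>\<^sub>m \<one> B)) \<cdot> d (A \<otimes>\<^sub>o B))) =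
    (Dup2 A B \<otimes>\<^sub>m \<one> B) \<cdot> (((c \<cdot> g) \<otimes>\<^sub>m ((c \<cdot> (\<epsilon> W \<cdot> p)) \<otimes>\<^sub>m \<one> B)) \<cdot> d (A \<otimes>\<^sub>o B))"
    by (simp add: cs) (simp add: inter)
  also have "c \<cdot> (\<epsilon> W \<cdot> p) = p"
    by (subst comp_eq_tail[of c]) (auto simp: c_def W_def cotens_eps p_def)
  \<comment> \<open>The \<open>\<e> B\<close> inside \<open>p\<close> erases one copy of the second
    factor; the \<open>\<epsilon> A\<close> inside \<open>p\<close> is the one in the monoidal
    rule.\<close>
  also have "(Dup2 A B \<otimes>\<^sub>m \<one> B) \<cdot> (((c \<cdot> g) \<otimes>\<^sub>m (p \<otimes>\<^sub>m \<one> B)) \<cdot> d (A \<otimes>\<^sub>o B)) =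
    ((Dup2 A B \<cdot> (\<one> (!\<^sub>o A) \<otimes>\<^sub>m (\<one> (!\<^sub>o B) \<otimes>\<^sub>m (\<one> (!\<^sub>o A) \<otimes>\<^sub>m \<e> B)))) \<otimes>\<^sub>m \<one> B) \<cdot>
     ((\<m>\<^sub>\<otimes> A B \<otimes>\<^sub>m (\<epsilon> A \<otimes>\<^sub>m \<one> B)) \<cdot> d (A \<otimes>\<^sub>o B))"
    by (subst whisker_comp_tail[symmetric]) (simp_all add: cg W_def p_def inter)
  also have "\<dots> = (\<Delta> A \<otimes>\<^sub>m \<one> (!\<^sub>o B) \<otimes>\<^sub>m \<one> B) \<cdot> (\<one> (!\<^sub>o A) \<otimes>\<^sub>m \<sigma> (!\<^sub>o A) (!\<^sub>o B) \<otimes>\<^sub>m \<one> B) \<cdot>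
      (\<m>\<^sub>\<otimes> A B \<otimes>\<^sub>m \<epsilon> A \<otimes>\<^sub>m \<one> B) \<cdot> d (A \<otimes>\<^sub>o B)"
    by (subst Dup2_counit_right, simp, simp, subst whisker_comp_tail[symmetric]) simp_all
  finally show "(\<one> (!\<^sub>o A) \<otimes>\<^sub>m d B) \<cdot> \<m>\<^sub>\<otimes> A B =
      (\<Delta> A \<otimes>\<^sub>m \<one> (!\<^sub>o B) \<otimes>\<^sub>m \<one> B) \<cdot> (\<one> (!\<^sub>o A) \<otimes>\<^sub>m \<sigma> (!\<^sub>o A) (!\<^sub>o B) \<otimes>\<^sub>m \<one> B) \<cdot>
      (\<m>\<^sub>\<otimes> A B \<otimes>\<^sub>m \<epsilon> A \<otimes>\<^sub>m \<one> B) \<cdot> d (A \<otimes>\<^sub>o B)"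
    by (simp only: 2 3[symmetric])
qed

section \<open>From the monoidal rule to the \<nabla>-rule\<close>

text \<open>The chain rule at the origin: \<open>\<Delta>\<close> copies \<open>nabla_unit A\<close>
  into both slots, and the copy in front of the inner \<open>d A\<close> completes it to
  \<open>eta A\<close>.\<close>

lemma eta_delta:
  assumes "chain_rule d" "A \<in> Ob X"
  shows "eta A \<cdot> \<delta> A = ((nabla_unit A \<cdot> \<delta> A) \<otimes>\<^sub>m eta A) \<cdot> d (!\<^sub>o A)"
proof -
  have "eta A \<cdot> \<delta> A = (nabla_unit A \<otimes>\<^sub>m \<one> A) \<cdot> ((\<Delta> A \<otimes>\<^sub>m \<one> A) \<cdot> ((\<delta> A \<otimes>\<^sub>m d A) \<cdot> d (!\<^sub>o A)))"
    using assms by (simp add: eta_def chain_rule_def)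
  also have "\<dots> = (nabla_unit A \<otimes>\<^sub>m (nabla_unit A \<otimes>\<^sub>m \<one> A)) \<cdot> ((\<delta> A \<otimes>\<^sub>m d A) \<cdot> d (!\<^sub>o A))"
    using assms(2) by (simp add: inter nabla_unit_Delta)
  also have "\<dots> = ((nabla_unit A \<cdot> \<delta> A) \<otimes>\<^sub>m eta A) \<cdot> d (!\<^sub>o A)"
    using assms(2) by (simp add: inter eta_def)
  finally show ?thesis .
qed

text \<open>Expanding \<open>\<nabla>\<close> and applying \<open>eta_delta\<close> in the second
  factor exposes a \<open>d\<close> in front of \<open>\<m>\<^sub>\<otimes>\<close>, which the
  monoidal rule moves past it. The point then becomes a product with the unit, and the direction
  becomes \<open>\<e> A \<otimes>\<^sub>m \<one> A\<close>.\<close>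

lemma eta_nabla_of_monoidal_rule:
  assumes L: "linear_rule d" and C: "chain_rule d" and M: "monoidal_rule d" and A [simp]: "A \<in> Ob X"
  shows "(\<one> (!\<^sub>o A) \<otimes>\<^sub>m eta A) \<cdot> \<nabla> A = d A"
proof -
  let ?s = "\<epsilon> A \<otimes>\<^sub>m \<e> A \<^bold>+ \<e> A \<otimes>\<^sub>m \<epsilon> A" and ?I = "\<one> (!\<^sub>o A)" and ?J = "\<one> (!\<^sub>o (!\<^sub>o A))"
  let ?W = "!\<^sub>o A \<otimes>\<^sub>o !\<^sub>o A" and ?u = "nabla_unit A" and ?B = "!\<^sub>o (!\<^sub>o A)" and ?m = "\<m>\<^sub>\<otimes> (!\<^sub>o A) (!\<^sub>o A)"
  have M': "(?J \<otimes>\<^sub>m d (!\<^sub>o A)) \<cdot> ?m =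
    (\<Delta> (!\<^sub>o A) \<otimes>\<^sub>m (?J \<otimes>\<^sub>m ?I)) \<cdot> (middle_swap ?B ?B ?B (!\<^sub>o A) \<cdot> ((?m \<otimes>\<^sub>m (\<epsilon> (!\<^sub>o A) \<otimes>\<^sub>m ?I)) \<cdot> d ?W))"
    using M by (simp add: monoidal_rule_def middle_swap_def)
  have "(?I \<otimes>\<^sub>m eta A) \<cdot> \<nabla> A =
    (\<delta> A \<otimes>\<^sub>m ((?u \<cdot> \<delta> A) \<otimes>\<^sub>m eta A)) \<cdot> ((?J \<otimes>\<^sub>m d (!\<^sub>o A)) \<cdot> (?m \<cdot> !\<^sub>m ?s))"
    by (simp add: comp_nabla eta_delta[OF C]) (simp add: inter)
  also have "\<dots> = (\<delta> A \<otimes>\<^sub>m ((?u \<cdot> \<delta> A) \<otimes>\<^sub>m eta A)) \<cdot> ((\<Delta> (!\<^sub>o A) \<otimes>\<^sub>m (?J \<otimes>\<^sub>m ?I)) \<cdot> (middle_swap ?B ?B ?B (!\<^sub>o A) \<cdot>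
     ((?m \<otimes>\<^sub>m (\<epsilon> (!\<^sub>o A) \<otimes>\<^sub>m ?I)) \<cdot> (d ?W \<cdot> !\<^sub>m ?s))))"
    by (subst comp_eq_tail[OF M']) simp_all
  \<comment> \<open>Naturality of \<open>d\<close> at \<open>?s\<close> puts one copy of
    \<open>?s\<close> under \<open>!\<close> in the point and another, bare, in the
    direction.\<close>
  also have "\<dots> = (\<delta> A \<otimes>\<^sub>m ((?u \<cdot> \<delta> A) \<otimes>\<^sub>m eta A)) \<cdot> ((\<Delta> (!\<^sub>o A) \<otimes>\<^sub>m (?J \<otimes>\<^sub>m ?I)) \<cdot> (middle_swap ?B ?B ?B (!\<^sub>o A) \<cdot>
     (((?m \<cdot> !\<^sub>m ?s) \<otimes>\<^sub>m ((\<epsilon> (!\<^sub>o A) \<otimes>\<^sub>m ?I) \<cdot> ?s)) \<cdot> d A)))"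
    by (simp add: d_nat') (simp add: inter)
  also have "\<dots> = (\<Delta> A \<otimes>\<^sub>m \<one> A) \<cdot> ((\<delta> A \<otimes>\<^sub>m (\<delta> A \<otimes>\<^sub>m ((?u \<cdot> \<delta> A) \<otimes>\<^sub>m eta A))) \<cdot> (middle_swap ?B ?B ?B (!\<^sub>o A) \<cdot>
     (((?m \<cdot> !\<^sub>m ?s) \<otimes>\<^sub>m ((\<epsilon> (!\<^sub>o A) \<otimes>\<^sub>m ?I) \<cdot> ?s)) \<cdot> d A)))"
    by (simp add: inter delta_Delta)
  also have "\<dots> = (\<Delta> A \<otimes>\<^sub>m \<one> A) \<cdot> ((\<delta> A \<otimes>\<^sub>m ((?u \<cdot> \<delta> A) \<otimes>\<^sub>m (\<delta> A \<otimes>\<^sub>m eta A))) \<cdot>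
     (((?m \<cdot> !\<^sub>m ?s) \<otimes>\<^sub>m ((\<epsilon> (!\<^sub>o A) \<otimes>\<^sub>m ?I) \<cdot> ?s)) \<cdot> d A))"
    by (simp add: comp_eq_tail[OF middle_swap_nat]) (simp add: middle_swap_def sym_unit)
  also have "\<dots> = (\<Delta> A \<otimes>\<^sub>m \<one> A) \<cdot> ((((?I \<otimes>\<^sub>m ?u) \<cdot> \<nabla> A) \<otimes>\<^sub>m ((?I \<otimes>\<^sub>m eta A) \<cdot> ?s)) \<cdot> d A)"
    by (simp add: comp_nabla) (simp add: inter)
  \<comment> \<open>\<open>eta A\<close> followed by \<open>\<e> A\<close> is zero, so only the
    second summand of \<open>?s\<close> survives.\<close>
  also have "(?I \<otimes>\<^sub>m eta A) \<cdot> ?s = \<e> A \<otimes>\<^sub>m \<one> A"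
    by (simp add: distrib inter eta_e eta_eps[OF L])
  also have "(\<Delta> A \<otimes>\<^sub>m \<one> A) \<cdot> ((((?I \<otimes>\<^sub>m ?u) \<cdot> \<nabla> A) \<otimes>\<^sub>m (\<e> A \<otimes>\<^sub>m \<one> A)) \<cdot> d A) = d A"
    by (simp add: nabla_unit_right) (simp add: inter)
  finally show ?thesis .
qed

end

theorem corollary6p11:
  fixes X :: "('o, 'm, 'z) lincat_scheme" and d :: "'o \<Rightarrow> 'm"
  assumes "additive_linear_category X"
    and "coalgebra_modality.natural_d X d"
  shows "(coalgebra_modality.deriving_transformation X d \<longleftrightarrow>
           coalgebra_modality.product_rule X d \<and> coalgebra_modality.linear_rule X d \<and>
           coalgebra_modality.chain_rule X d) \<and>
         (coalgebra_modality.deriving_transformation X d \<longleftrightarrow>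
           coalgebra_modality.linear_rule X d \<and> coalgebra_modality.chain_rule X d \<and>
           additive_linear_category.nabla_rule X d) \<and>
         (coalgebra_modality.deriving_transformation X d \<longleftrightarrow>
           coalgebra_modality.linear_rule X d \<and> coalgebra_modality.chain_rule X d \<and>
           additive_linear_category.monoidal_rule X d)"
proof -
  interpret additive_linear_category X by (rule assms(1))
  interpret differential X d by unfold_locales (rule assms(2))
  have "nabla_rule d" if "linear_rule d" "chain_rule d" "monoidal_rule d"
    using that by (intro nabla_rule_of_eta_nabla) (simp add: eta_nabla_of_monoidal_rule)
  \<comment> \<open>The implications form a cycle modulo the linear and chain rules: product to
    monoidal, monoidal to \<nabla>, \<nabla> to product. The \<nabla>-rule also supplies
    interchange, and the constant rule always holds.\<close>
  then show ?thesis
    using monoidal_rule_of_product_rule product_rule_of_nabla_rule interchange_rule_of_nabla_rule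
      natural_d constant_rule
    unfolding deriving_transformation_def by blast
qed

end
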